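(* Let $\nu>-1$ and $q\in(0,1)$. Let $g_{\nu}^{(2)}(z;q)=2^{\nu}c_{\nu}(q)z^{1-\nu}J_{\nu}^{(2)}(z;q)$. Then the radius of convexity $r^{c}\left(g_{\nu}^{(2)}(z;q)\right)$ of the function $z\mapsto g_{\nu}^{(2)}(z;q)$ is the smallest positive root of the equation (in $r$) $$(1-\nu)^2 J_{\nu}^{(2)}(r;q)+(3-2\nu)\,r\,\frac{dJ_{\nu}^{(2)}(r;q)}{dr}+r^2\frac{d^2J_{\nu}^{(2)}(r;q)}{dr^2}=0$$ and satisfies the following inequalities: $$\sqrt{\frac{4\left(1-q^{\nu+1}\right)\left(1-q\right)}{9q^{\nu+1}}} <r^{c}\left(g_{\nu}^{(2)}(z;q)\right)<\sqrt{\frac{36(q^2-1)\left(1-q^{\nu+1}\right)\left(1-q^{\nu+2}\right)}{q^{\nu+1}S_{\nu}(q)}},$$ $$2\sqrt[4]{\frac{(1+q)(1-q)^2\left(1-q^{\nu+1}\right)^2\left(q^{\nu+2}-1\right)}{q^{2(\nu+1)}S_{\nu}(q)}}<r^{c}\left(g_{\nu}^{(2)}(z;q)\right)<\sqrt{\frac{4\left(1-q^{\nu+1}\right)\left(1-q^{\nu+3}\right)T(q)S_{\nu}(q)}{q^{\nu+1}(1+q)\left(P_{\nu}(q)+R_{\nu}(q)\right)}},$$ where $$P_{\nu}(q)=1458q-729q^{\nu+2}-1512q^{\nu+3}-2241q^{\nu+4}-837q^{\nu+5}-54q^{\nu+6}+479q^{\nu+7}+729q^{2\nu+5},$$ $$R_{\nu}(q)=783q^{2\nu+6}+783q^{2\nu+7}+152q^{2\nu+8}+98q^6-675q^4+54q^3+783q^2+729,$$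 $$S_{\nu}(q)=31q^{\nu+3}+81q^{\nu+2}+50q^2-81q-81,$$ $$T(q)=(q-1)(q^3+2q^2+2q+1).$$
   Context: For $q\in(0,1)$ and $a\in\mathbb{R}$: $(a;q)_0=1$, $(a;q)_n=\prod_{k=1}^{n}(1-aq^{k-1})$, $(a;q)_\infty=\prod_{k\ge1}(1-aq^{k-1})$. The Jackson $q$-Bessel function is, for $\nu>-1$, $$J_{\nu}^{(2)}(z;q)=\frac{(q^{\nu+1};q)_{\infty}}{(q;q)_{\infty}}\sum_{n\geq0}\frac{(-1)^{n}\left(\frac{z}{2}\right)^{2n+\nu}}{(q;q)_{n}(q^{\nu+1};q)_{n}}q^{n(n+\nu)}.$$ Put $c_{\nu}(q)=(q;q)_{\infty}/(q^{\nu+1};q)_{\infty}$. The normalized function $g_\nu^{(2)}$ is understood as the entire function $$g_{\nu}^{(2)}(z;q)=2^{\nu}c_{\nu}(q)z^{1-\nu}J_{\nu}^{(2)}(z;q)=\sum_{n\geq0}\frac{(-1)^nq^{n(n+\nu)}}{4^n(q;q)_{n}(q^{\nu+1};q)_{n}}z^{2n+1}.$$ With $\mathbb{D}_r=\{z\in\mathbb{C}:|z|<r\}$, the radius of convexity of an analytic function $f$ (with $f'(0)\neq0$) is $$r^{c}(f)=\sup\left\{r>0:\Re\left(1+\frac{zf''(z)}{f'(z)}\right)>0\text{ for all }z\in\mathbb{D}_r\right\}.$$ *)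

theory Defs
  imports "HOL-Analysis.Analysis"
begin

definition qpoch :: "real \<Rightarrow> real \<Rightarrow> nat \<Rightarrow> real" where
  "qpoch a q n = (\<Prod>k=1..n. 1 - a * q ^ (k - 1))"

definition qpoch_inf :: "real \<Rightarrow> real \<Rightarrow> real" where
  "qpoch_inf a q = (\<Prod>k. 1 - a * q ^ k)"

text \<open>Complex powers are principal values. Since \<open>0 powr w = 0\<close> for every \<open>w\<close>, the value at
  \<open>z = 0\<close> is the intended one only for \<open>\<nu> > 0\<close>; the value there is never used below.\<close>

definition jackson_bessel2 :: "real \<Rightarrow> real \<Rightarrow> complex \<Rightarrow> complex" where
  "jackson_bessel2 \<nu> q z =
     of_real (qpoch_inf (q powr (\<nu> + 1)) q / qpoch_inf q q) *
     (\<Sum>n. (-1) ^ n * (z / 2) powr of_real (2 * real n + \<nu>)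
            / of_real (qpoch q q n * qpoch (q powr (\<nu> + 1)) q n)
            * of_real (q powr (real n * (real n + \<nu>))))"

definition bessel_c :: "real \<Rightarrow> real \<Rightarrow> real" where
  "bessel_c \<nu> q = qpoch_inf q q / qpoch_inf (q powr (\<nu> + 1)) q"

text \<open>The branch cuts of the two factors cancel and the value at \<open>0\<close> is \<open>0\<close>, so this is the
  entire function given by the power series in \<open>normalized_bessel2_series\<close> below.\<close>

definition normalized_bessel2 :: "real \<Rightarrow> real \<Rightarrow> complex \<Rightarrow> complex" where
  "normalized_bessel2 \<nu> q z =
     of_real (2 powr \<nu> * bessel_c \<nu> q) * z powr of_real (1 - \<nu>) * jackson_bessel2 \<nu> q z"

text \<open>The quotient \<open>f'' / f'\<close> has to be defined on the whole disc, hence the condition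
  \<open>deriv f z \<noteq> 0\<close> (division by zero is total in HOL). The supremum is taken in the extended
  reals, so that it is meaningful for unbounded sets of radii.\<close>

definition radius_of_convexity :: "(complex \<Rightarrow> complex) \<Rightarrow> ereal" where
  "radius_of_convexity f =
     Sup (ereal ` {r. r > 0 \<and> (\<forall>z\<in>ball 0 r. deriv f z \<noteq> 0 \<and>
                     Re (1 + z * deriv (deriv f) z / deriv f z) > 0)})"

definition smallest_positive_root :: "(real \<Rightarrow> complex) \<Rightarrow> real \<Rightarrow> bool" where
  "smallest_positive_root F r \<longleftrightarrow> r > 0 \<and> F r = 0 \<and> (\<forall>s. s > 0 \<and> F s = 0 \<longrightarrow> r \<le> s)"

definition P_poly :: "real \<Rightarrow> real \<Rightarrow> real" where
  "P_poly \<nu> q = 1458 * q - 729 * q powr (\<nu> + 2) - 1512 * q powr (\<nu> + 3)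
     - 2241 * q powr (\<nu> + 4) - 837 * q powr (\<nu> + 5) - 54 * q powr (\<nu> + 6)
     + 479 * q powr (\<nu> + 7) + 729 * q powr (2 * \<nu> + 5)"

definition R_poly :: "real \<Rightarrow> real \<Rightarrow> real" where
  "R_poly \<nu> q = 783 * q powr (2 * \<nu> + 6) + 783 * q powr (2 * \<nu> + 7) + 152 * q powr (2 * \<nu> + 8)
     + 98 * q ^ 6 - 675 * q ^ 4 + 54 * q ^ 3 + 783 * q ^ 2 + 729"

definition S_poly :: "real \<Rightarrow> real \<Rightarrow> real" where
  "S_poly \<nu> q = 31 * q powr (\<nu> + 3) + 81 * q powr (\<nu> + 2) + 50 * q ^ 2 - 81 * q - 81"

definition T_poly :: "real \<Rightarrow> real" where
  "T_poly q = (q - 1) * (q ^ 3 + 2 * q ^ 2 + 2 * q + 1)"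

lemma qpoch_Suc: "qpoch a q (Suc n) = qpoch a q n * (1 - a * q ^ n)"
  by (simp add: qpoch_def)

lemma qpowr_bounds:
  fixes q :: real
  assumes "- 1 < \<nu>" "0 < q" "q < 1"
  shows "0 < q powr (\<nu> + 1)" and "q powr (\<nu> + 1) < 1"
  using assms by (auto simp: powr_def mult_pos_neg)

lemma qfactor_pos:
  fixes a q :: real
  assumes "0 < a" "a < 1" "0 < q" "q < 1"
  shows "0 < 1 - a * q ^ n"
proof -
  have "q ^ n \<le> 1" using assms by (simp add: power_le_one)
  then have "a * q ^ n \<le> a" using assms by (simp add: mult_left_le)
  then show ?thesis using assms by linarith
qed

lemma qpoch_pos:
  assumes "0 < a" "a < 1" "0 < q" "q < 1"
  shows "0 < qpoch a q n"
  unfolding qpoch_def using qfactor_pos[OF assms] by (intro prod_pos) auto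

lemma qpoch_inf_nonzero:
  assumes "0 < a" "a < 1" "0 < q" "q < 1"
  shows "convergent_prod (\<lambda>k. 1 - a * q ^ k)" and "qpoch_inf a q \<noteq> 0"
proof -
  have "summable (\<lambda>k. norm (- (a * q ^ k)))"
    using assms by (auto intro!: summable_mult summable_geometric)
  then have "summable (\<lambda>k. norm ((1 - a * q ^ k) - 1))"
    by simp
  then show c: "convergent_prod (\<lambda>k. 1 - a * q ^ k)"
    by (metis abs_convergent_prod_conv_summable abs_convergent_prod_imp_convergent_prod)
  have "1 - a * q ^ k \<noteq> 0" for k
    using qfactor_pos[OF assms, of k] by linarith
  with c show "qpoch_inf a q \<noteq> 0"
    unfolding qpoch_inf_def by (intro prodinf_nonzero) auto
qed

lemma normalized_bessel2_summable:
  fixes z :: complex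
  assumes nu: "- 1 < \<nu>" and q: "0 < q" "q < 1"
  shows "summable (\<lambda>n. (-1) ^ n * of_real (q powr (real n * (real n + \<nu>)))
           / of_real (4 ^ n * qpoch q q n * qpoch (q powr (\<nu> + 1)) q n) * z ^ (2 * n + 1))"
    (is "summable ?f")
proof -
  let ?b = "q powr (\<nu> + 1)"
  have b: "0 < ?b" "?b < 1"
    using nu q qpowr_bounds by blast+
  define \<rho> where "\<rho> n = q ^ n * q ^ n * ?b * (norm z)\<^sup>2 / (4 * (1 - q * q ^ n) * (1 - ?b * q ^ n))" for n
  have q0: "(\<lambda>n. q ^ n) \<longlonglongrightarrow> 0"
    using q by (intro LIMSEQ_realpow_zero) auto
  have "\<rho> \<longlonglongrightarrow> 0 * 0 * ?b * (norm z)\<^sup>2 / (4 * (1 - q * 0) * (1 - ?b * 0))"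
    unfolding \<rho>_def by (intro tendsto_intros q0) auto
  then have "\<rho> \<longlonglongrightarrow> 0" by simp
  then have "\<forall>\<^sub>F n in sequentially. \<rho> n < 1 / 2"
    by (rule order_tendstoD) simp
  then obtain N where N: "\<And>n. n \<ge> N \<Longrightarrow> \<rho> n < 1 / 2"
    by (auto simp: eventually_sequentially)
  have step: "norm (?f (Suc n)) = \<rho> n * norm (?f n)" for n
  proof -
    have "real (Suc n) * (real (Suc n) + \<nu>) = real n * (real n + \<nu>) + real n + real n + (\<nu> + 1)"
      by (simp add: algebra_simps)
    then have e: "q powr (real (Suc n) * (real (Suc n) + \<nu>)) =
        q powr (real n * (real n + \<nu>)) * q ^ n * q ^ n * ?b"
      using q by (simp only: powr_add powr_realpow)
    have p: "0 < qpoch q q n" "0 < qpoch ?b q n" "0 < 1 - q * q ^ n" "0 < 1 - ?b * q ^ n"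
      using qpoch_pos qfactor_pos q b by blast+
    have zz: "z ^ (2 * Suc n + 1) = z ^ (2 * n + 1) * z\<^sup>2"
      by (simp add: power2_eq_square)
    define u v where "u = 1 - q * q ^ n" and "v = 1 - ?b * q ^ n"
    show ?thesis
      using p unfolding e qpoch_Suc zz \<rho>_def u_def[symmetric] v_def[symmetric]
      using q b by (simp add: norm_mult norm_divide norm_power abs_mult mult_ac)
  qed
  show ?thesis
  proof (rule summable_ratio_test)
    show "(1 / 2 :: real) < 1" by simp
    fix n assume "N \<le> n"
    then show "norm (?f (Suc n)) \<le> 1 / 2 * norm (?f n)"
      unfolding step using N[of n] by (intro mult_right_mono) auto
  qed
qed

theorem normalized_bessel2_series:
  assumes nu: "- 1 < \<nu>" and q: "0 < q" "q < 1"
  shows "normalized_bessel2 \<nu> q z =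
    (\<Sum>n. (-1) ^ n * of_real (q powr (real n * (real n + \<nu>)))
           / of_real (4 ^ n * qpoch q q n * qpoch (q powr (\<nu> + 1)) q n) * z ^ (2 * n + 1))"
    (is "_ = suminf ?f")
proof (cases "z = 0")
  case True
  then show ?thesis by (simp add: normalized_bessel2_def)
next
  case False
  let ?b = "q powr (\<nu> + 1)"
  have b: "0 < ?b" "?b < 1"
    using nu q qpowr_bounds by blast+
  have nz: "qpoch_inf q q \<noteq> 0" "qpoch_inf ?b q \<noteq> 0"
    using qpoch_inf_nonzero(2) q b by blast+
  define C where "C = z powr of_real (\<nu> - 1) / of_real (2 powr \<nu>)"
  have zp: "(z / 2) powr of_real (2 * real n + \<nu>) = C * (z ^ (2 * n + 1) / 4 ^ n)" for n
  proof -
    have "Ln (z / 2) = Ln z - of_real (ln 2)"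
      using False Ln_divide_of_real[of 2 z] by simp
    then have "(z / 2) powr of_real (2 * real n + \<nu>)
        = exp (of_real (2 * real n + \<nu>) * Ln z) / exp (of_real (2 * real n + \<nu>) * of_real (ln 2))"
      using False by (simp add: powr_def right_diff_distrib exp_diff)
    also have "exp (of_real (2 * real n + \<nu>) * complex_of_real (ln 2))
        = of_real (2 powr (2 * real n + \<nu>))"
      by (simp add: powr_def exp_of_real[symmetric])
    also have "2 powr (2 * real n + \<nu>) = 4 ^ n * 2 powr \<nu>"
    proof -
      have "(2::real) powr (2 * real n) = 4 ^ n"
        using powr_realpow[of 2 "2 * n"] by (simp add: power_mult)
      then show ?thesis by (simp add: powr_add)
    qed
    also have "exp (of_real (2 * real n + \<nu>) * Ln z) = z powr of_real (\<nu> - 1) * z ^ (2 * n + 1)"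
    proof -
      have "z powr (of_real (\<nu> - 1) + of_nat (2 * n + 1)) = z powr of_real (\<nu> - 1) * z ^ (2 * n + 1)"
        using False by (simp only: powr_add powr_nat' False simp_thms)
      moreover have "of_real (\<nu> - 1) + of_nat (2 * n + 1) = complex_of_real (2 * real n + \<nu>)"
        by simp
      ultimately show ?thesis using False by (simp add: powr_def add.commute)
    qed
    finally show ?thesis by (simp add: C_def)
  qed
  have "(\<Sum>n. (-1) ^ n * (z / 2) powr of_real (2 * real n + \<nu>)
            / of_real (qpoch q q n * qpoch ?b q n) * of_real (q powr (real n * (real n + \<nu>))))
        = (\<Sum>n. C * ?f n)"
    unfolding zp by (intro suminf_cong) (simp add: field_simps)
  also have "\<dots> = C * suminf ?f"
    by (intro suminf_mult normalized_bessel2_summable assms)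
  finally have J: "jackson_bessel2 \<nu> q z = of_real (qpoch_inf ?b q / qpoch_inf q q) * (C * suminf ?f)"
    unfolding jackson_bessel2_def by simp
  have "z powr of_real (1 - \<nu>) * z powr of_real (\<nu> - 1) = 1"
    using False by (simp add: powr_add[symmetric] powr_def exp_add[symmetric] algebra_simps)
  then have "of_real (2 powr \<nu>) * z powr of_real (1 - \<nu>) * C = 1"
    by (simp add: C_def)
  moreover have "complex_of_real (bessel_c \<nu> q) * of_real (qpoch_inf ?b q / qpoch_inf q q) = 1"
    using nz by (simp add: bessel_c_def)
  moreover have "a * w * c = 1 \<Longrightarrow> d * e = 1 \<Longrightarrow> (a * d) * w * (e * c) = 1" for a w c d e :: complex
    by algebra
  ultimately have "of_real (2 powr \<nu> * bessel_c \<nu> q) * z powr of_real (1 - \<nu>)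
      * (of_real (qpoch_inf ?b q / qpoch_inf q q) * C) = 1"
    by (simp only: of_real_mult)
  then have "(of_real (2 powr \<nu> * bessel_c \<nu> q) * z powr of_real (1 - \<nu>)
      * (of_real (qpoch_inf ?b q / qpoch_inf q q) * C)) * suminf ?f = suminf ?f"
    by (simp only: mult_1)
  then show ?thesis
    unfolding normalized_bessel2_def J by (simp only: mult.assoc)
qed

end

theory Submission
  imports Defs "HOL-Computational_Algebra.Fundamental_Theorem_Algebra"
begin

text \<open>
  Write \<open>g\<close> for the normalized function, \<open>b = q powr (\<nu> + 1)\<close>, and \<open>F e w\<close> for the power series
  with coefficients \<open>(-1)\<^sup>n e n\<close> (\<open>alt_series\<close>). Then \<open>g z = z F a (z\<^sup>2)\<close> with positive coefficients
  \<open>a\<close>, and the operator \<open>z d/dz\<close> on such odd functions multiplies the \<open>n\<close>-th coefficient by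
  \<open>2 n + 1\<close>. Hence \<open>1 + z g'' / g' = F e (z\<^sup>2) / F d (z\<^sup>2)\<close> where \<open>d n = (2 n + 1) a n\<close> and
  \<open>e n = (2 n + 1)\<^sup>2 a n\<close>, and the radius of convexity is \<open>sqrt \<gamma>\<close> for the least positive zero
  \<open>\<gamma>\<close> of \<open>F e\<close>. The equation in the theorem is \<open>F e (r\<^sup>2) = 0\<close> up to a nonvanishing factor
  (\<open>bessel_equation\<close>).

  All this rests on the fact that \<open>F a\<close>, \<open>F d\<close> and \<open>F e\<close> are limits of polynomials with only
  positive zeros. For \<open>F a\<close> the polynomials come from the three-term recurrence of the Bessel
  functions in the order \<open>\<nu>\<close>, truncated at order \<open>\<nu> + N\<close>; their zeros are real by a
  Christoffel-Darboux argument (\<open>lommel_Im\<close>) and positive by the signs of the coefficients, and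
  their coefficients increase to those of the Bessel series (\<open>lommel_coeff_tendsto\<close>). The operator
  \<open>z d/dz\<close> preserves positivity of the zeros (\<open>theta_rootprod\<close>), which covers \<open>F d\<close> and \<open>F e\<close>.

  For a product of factors \<open>1 - x w\<close> with \<open>x > 0\<close>, the real part of the quotient above is smallest on a
  circle at its positive point (\<open>Re_theta_quotient_ge\<close>), so that the first obstruction to convexity
  lies on the positive axis (\<open>radius_of_convexity_odd_series\<close>). The bounds are Euler-Rayleigh
  inequalities: if \<open>s k\<close> is the sum of the \<open>k\<close>-th powers of the reciprocal zeros of \<open>F e\<close>, a
  polynomial in \<open>e 1, \<dots>, e k\<close>, then \<open>1 / s k \<le> \<gamma>\<^sup>k\<close> and \<open>\<gamma> \<le> s k / s (k + 1)\<close>. Limits give them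
  only as weak inequalities. They are therefore used for \<open>s 2\<close> and \<open>s 3\<close> alone, in the forms
  \<open>1 \<le> \<gamma>\<^sup>3 s 3\<close> and \<open>\<gamma> \<le> s 2 / s 3\<close> (\<open>least_zero\<close>), and the strict inequalities follow from
  explicit gaps between consecutive bounds (\<open>psum_gaps\<close>).
\<close>

section \<open>Polynomials with positive zeros\<close>

text \<open>Polynomials are normalized to the value \<open>1\<close> at \<open>0\<close> and given by the list \<open>X\<close> of the
  reciprocals of their zeros, because the sums of powers of these reciprocals remain meaningful
  when the degree tends to infinity.\<close>

definition rootprod :: "real list \<Rightarrow> complex poly" where
  "rootprod X = (\<Prod>x\<leftarrow>X. [:1, - of_real x:])"

definition powsum :: "nat \<Rightarrow> real list \<Rightarrow> real" where
  "powsum k X = (\<Sum>x\<leftarrow>X. x ^ k)"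

lemma rootprod_simps [simp]:
  "rootprod [] = 1" "rootprod (x # X) = [:1, - of_real x:] * rootprod X"
  by (simp_all add: rootprod_def)

lemma powsum_simps [simp]: "powsum k [] = 0" "powsum k (x # X) = x ^ k + powsum k X"
  by (simp_all add: powsum_def)

lemma powsum_nonneg: "\<forall>x\<in>set X. 0 < x \<Longrightarrow> 0 \<le> powsum k X"
  by (induction X) auto

lemma power_le_powsum: "\<forall>x\<in>set X. 0 < x \<Longrightarrow> x \<in> set X \<Longrightarrow> x ^ k \<le> powsum k X"
proof (induction X)
  case (Cons y X)
  then show ?case using powsum_nonneg[of X k] by (auto intro: add_increasing)
qed simp

lemma powsum_Suc_le:
  assumes "\<forall>x\<in>set X. 0 < x \<and> c * x \<le> 1"
  shows "c * powsum (Suc k) X \<le> powsum k X"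
  using assms
proof (induction X)
  case (Cons y X)
  have "(c * y) * y ^ k \<le> 1 * y ^ k" using Cons.prems by (intro mult_right_mono) auto
  moreover have "c * powsum (Suc k) X \<le> powsum k X" using Cons by simp
  ultimately show ?case by (simp only: powsum_simps power_Suc distrib_left mult.assoc mult_1)
qed simp

lemma poly_rootprod_Cons: "poly (rootprod (x # X)) w = (1 - of_real x * w) * poly (rootprod X) w"
  by (simp add: algebra_simps)

lemma poly_rootprod_eq_0: "poly (rootprod X) w = 0 \<longleftrightarrow> (\<exists>x\<in>set X. of_real x * w = 1)"
  by (induction X) (auto simp: poly_rootprod_Cons simp del: rootprod_simps(2))

lemma coeff_rootprod_Suc:
  "coeff (rootprod (x # X)) (Suc n) = coeff (rootprod X) (Suc n) - of_real x * coeff (rootprod X) n"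
  by simp

text \<open>Newton's identities, up to the third power sum.\<close>

lemma newton_rootprod:
  "coeff (rootprod X) 0 = 1"
  "coeff (rootprod X) 1 = - of_real (powsum 1 X)"
  "2 * coeff (rootprod X) 2 = of_real ((powsum 1 X)\<^sup>2 - powsum 2 X)"
  "6 * coeff (rootprod X) 3
     = - of_real (powsum 1 X ^ 3 - 3 * powsum 1 X * powsum 2 X + 2 * powsum 3 X)"
proof -
  show c0: "coeff (rootprod X) 0 = 1" for X by (induction X) auto
  show c1: "coeff (rootprod X) 1 = - of_real (powsum 1 X)" for X
  proof (induction X)
    case (Cons x X)
    then show ?case
      unfolding One_nat_def coeff_rootprod_Suc c0 by simp
  qed simp
  show c2: "2 * coeff (rootprod X) 2 = of_real ((powsum 1 X)\<^sup>2 - powsum 2 X)" for X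
  proof (induction X)
    case (Cons x X)
    have "2 * coeff (rootprod (x # X)) 2
        = 2 * coeff (rootprod X) 2 - 2 * of_real x * coeff (rootprod X) 1"
      using coeff_rootprod_Suc[of x X 1] by (simp add: numeral_2_eq_2 algebra_simps)
    also have "\<dots> = of_real ((powsum 1 (x # X))\<^sup>2 - powsum 2 (x # X))"
      unfolding Cons c1 by (simp add: power2_eq_square algebra_simps)
    finally show ?case .
  qed simp
  show "6 * coeff (rootprod X) 3
     = - of_real (powsum 1 X ^ 3 - 3 * powsum 1 X * powsum 2 X + 2 * powsum 3 X)" for X
  proof (induction X)
    case (Cons x X)
    have "6 * coeff (rootprod (x # X)) 3
        = 6 * coeff (rootprod X) 3 - 3 * of_real x * (2 * coeff (rootprod X) 2)"
      using coeff_rootprod_Suc[of x X 2] by (simp add: eval_nat_numeral algebra_simps)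
    also have "\<dots> = - of_real (powsum 1 (x # X) ^ 3 - 3 * powsum 1 (x # X) * powsum 2 (x # X)
        + 2 * powsum 3 (x # X))"
      unfolding Cons c2 by (simp add: power2_eq_square power3_eq_cube algebra_simps)
    finally show ?case .
  qed simp
qed

text \<open>A factor \<open>1 - x w\<close> with \<open>x > 0\<close> is smallest, on a circle inside the zero \<open>1 / x\<close>, at the
  positive point of the circle.\<close>

lemma norm_rootprod_ge:
  assumes "\<forall>x\<in>set X. 0 < x \<and> x * norm w < 1"
  shows "Re (poly (rootprod X) (of_real (norm w))) \<le> norm (poly (rootprod X) w)"
    and "0 < Re (poly (rootprod X) (of_real (norm w)))"
proof -
  have "0 < Re (poly (rootprod X) (of_real (norm w))) \<and>
        Re (poly (rootprod X) (of_real (norm w))) \<le> norm (poly (rootprod X) w)"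
    using assms
  proof (induction X)
    case (Cons x X)
    have "1 - x * norm w \<le> norm (1 - of_real x * w)"
      using norm_triangle_ineq2[of 1 "of_real x * w"] Cons.prems by (simp add: norm_mult)
    then have "(1 - x * norm w) * Re (poly (rootprod X) (of_real (norm w)))
        \<le> norm (1 - of_real x * w) * norm (poly (rootprod X) w)"
      using Cons by (intro mult_mono) auto
    moreover have "0 < (1 - x * norm w) * Re (poly (rootprod X) (of_real (norm w)))"
      using Cons by simp
    ultimately show ?case
      unfolding poly_rootprod_Cons norm_mult by simp
  qed simp
  then show "Re (poly (rootprod X) (of_real (norm w))) \<le> norm (poly (rootprod X) w)"
    and "0 < Re (poly (rootprod X) (of_real (norm w)))" by auto
qed

text \<open>The product of \<open>(1 - u) (1 + u)\<^sup>2 \<ge> 1 - u\<^sup>3\<close> over the numbers \<open>u = x w\<close>, combined with the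
  Weierstrass inequality: it excludes a zero at \<open>w\<close> as soon as the third power sum is smaller
  than \<open>1 / w\<^sup>3\<close>.\<close>

lemma rootprod_lower_bound:
  assumes "\<forall>x\<in>set X. 0 < x" "0 \<le> w" "w ^ 3 * powsum 3 X < 1"
  shows "1 - w ^ 3 * powsum 3 X
    \<le> Re (poly (rootprod X) (of_real w)) * (Re (poly (rootprod X) (of_real (- w))))\<^sup>2"
proof -
  have lt1: "x * w < 1" if "x \<in> set X" for x
  proof -
    have "x ^ 3 * w ^ 3 \<le> powsum 3 X * w ^ 3"
      using power_le_powsum[OF assms(1) that, of 3] assms(2) by (intro mult_right_mono) auto
    then have "(x * w) ^ 3 < 1" using assms(3) by (simp add: power_mult_distrib mult.commute)
    then show ?thesis by (metis not_less one_le_power)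
  qed
  then have "\<forall>x\<in>set X. 0 < x \<and> x * w < 1" using assms(1) by blast
  then show ?thesis using assms(3)
  proof (induction X)
    case (Cons x X)
    define S Y where "S = w ^ 3 * powsum 3 X"
      and "Y = Re (poly (rootprod X) (of_real w)) * (Re (poly (rootprod X) (of_real (- w))))\<^sup>2"
    define u where "u = x * w"
    have u: "0 \<le> u" "u < 1" using Cons.prems assms(2) by (auto simp: u_def)
    have S: "0 \<le> S" using powsum_nonneg[of X 3] Cons.prems assms(2) by (simp add: S_def)
    have S1: "S + u ^ 3 < 1"
      using Cons.prems(2) by (simp add: S_def u_def power_mult_distrib algebra_simps)
    moreover have "0 \<le> u ^ 3" using u by simp
    ultimately have "S < 1" by linarith
    then have IH: "1 - S \<le> Y" using Cons unfolding S_def Y_def by simp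
    have "1 - (S + u ^ 3) \<le> (1 - u ^ 3) * (1 - S)"
      using S u by (simp add: algebra_simps)
    also have "\<dots> \<le> ((1 - u) * (1 + u)\<^sup>2) * Y"
    proof (rule mult_mono)
      have "(1 - u) * (1 + u)\<^sup>2 - (1 - u ^ 3) = u * (1 - u)"
        by (simp add: power2_eq_square power3_eq_cube algebra_simps)
      moreover have "0 \<le> u * (1 - u)" using u by simp
      ultimately show "1 - u ^ 3 \<le> (1 - u) * (1 + u)\<^sup>2" by linarith
    qed (use u IH \<open>S < 1\<close> in auto)
    also have "\<dots> = Re (poly (rootprod (x # X)) (of_real w)) *
        (Re (poly (rootprod (x # X)) (of_real (- w))))\<^sup>2"
    proof -
      have "Re (poly (rootprod (x # X)) (of_real w)) = (1 - u) * Re (poly (rootprod X) (of_real w))"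
        "Re (poly (rootprod (x # X)) (of_real (- w))) = (1 + u) * Re (poly (rootprod X) (of_real (- w)))"
        unfolding poly_rootprod_Cons by (simp_all add: u_def)
      then show ?thesis unfolding Y_def by (simp only: power_mult_distrib mult_ac)
    qed
    finally show ?case by (simp add: S_def u_def power_mult_distrib algebra_simps)
  qed simp
qed

text \<open>With \<open>w = z\<^sup>2\<close> this is the operator \<open>f \<mapsto> z f'\<close> on the odd functions \<open>f z = z p(z\<^sup>2)\<close>.\<close>

definition theta :: "complex poly \<Rightarrow> complex poly" where
  "theta p = p + smult 2 (pCons 0 (pderiv p))"

lemma coeff_theta: "coeff (theta p) n = of_nat (2 * n + 1) * coeff p n"
  by (cases n) (auto simp: theta_def coeff_pderiv algebra_simps)

lemma poly_theta_rootprod: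
  assumes "\<forall>x\<in>set X. of_real x * w \<noteq> 1"
  shows "poly (theta (rootprod X)) w
    = poly (rootprod X) w * (1 - 2 * (\<Sum>x\<leftarrow>X. of_real x * w / (1 - of_real x * w)))"
  using assms
proof (induction X)
  case (Cons x X)
  define S where "S = (\<Sum>x\<leftarrow>X. of_real x * w / (1 - of_real x * w))"
  have nz: "1 - of_real x * w \<noteq> 0" using Cons.prems by auto
  have deriv: "pderiv (rootprod (x # X))
      = [:1, - of_real x:] * pderiv (rootprod X) + smult (- of_real x) (rootprod X)"
    unfolding rootprod_simps pderiv_mult by (simp add: pderiv_pCons)
  have "poly (theta (rootprod (x # X))) w
      = (1 - of_real x * w) * poly (theta (rootprod X)) w - 2 * of_real x * w * poly (rootprod X) w"
    unfolding theta_def deriv by (simp add: algebra_simps)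
  also have "poly (theta (rootprod X)) w = poly (rootprod X) w * (1 - 2 * S)"
    unfolding S_def using Cons by simp
  also have "(1 - of_real x * w) * (poly (rootprod X) w * (1 - 2 * S))
        - 2 * of_real x * w * poly (rootprod X) w
      = ((1 - of_real x * w) * poly (rootprod X) w)
        * (1 - 2 * (of_real x * w / (1 - of_real x * w) + S))"
    using nz by (simp add: field_simps)
  finally show ?case unfolding poly_rootprod_Cons S_def by simp
qed (simp add: theta_def)

lemma exists_rootprod:
  assumes "coeff p 0 = 1" "\<And>z. poly p z = 0 \<Longrightarrow> \<exists>r>0. z = of_real r"
  shows "\<exists>X. (\<forall>x\<in>set X. 0 < x) \<and> p = rootprod X"
  using assms
proof (induction "degree p" arbitrary: p)
  case 0
  then have "p = 1" by (metis degree_eq_zeroE coeff_pCons_0 one_pCons)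
  then show ?case by (intro exI[of _ "[]"]) auto
next
  case (Suc n)
  have "\<not> constant (poly p)" using Suc.hyps(2) constant_degree[of p] by simp
  then obtain z where z: "poly p z = 0" using fundamental_theorem_of_algebra by blast
  then obtain r where r: "r > 0" "z = of_real r" using Suc.prems(2) by blast
  then have "[:- of_real r, 1:] dvd p" using z by (simp add: poly_eq_0_iff_dvd)
  then obtain q where q: "p = [:- of_real r, 1:] * q" by (elim dvdE)
  define q' where "q' = smult (- of_real r) q"
  have pq: "p = [:1, - of_real (1 / r):] * q'"
    using r by (simp add: q q'_def smult_add_right)
  have "p \<noteq> 0" using Suc.hyps(2) by auto
  then have "degree p = Suc (degree q')"
    unfolding pq by (subst degree_mult_eq) (use r in auto)
  then have "n = degree q'" using Suc.hyps(2) by simp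
  moreover have "coeff q' 0 = 1" using Suc.prems(1) by (simp add: pq)
  moreover have "\<exists>r>0. z = of_real r" if "poly q' z = 0" for z
    using Suc.prems(2)[of z] that by (simp add: pq)
  ultimately obtain X where "\<forall>x\<in>set X. 0 < x" "q' = rootprod X"
    using Suc.hyps(1) by blast
  then show ?case using r pq by (intro exI[of _ "1 / r # X"]) auto
qed

lemma Im_moebius:
  assumes "Im w \<noteq> 0" "x > 0"
  shows "of_real x * w \<noteq> 1" "Im w * Im (of_real x * w / (1 - of_real x * w)) > 0"
proof -
  show ne: "of_real x * w \<noteq> 1" using assms by (auto simp: complex_eq_iff)
  define d where "d = (1 - x * Re w)\<^sup>2 + (x * Im w)\<^sup>2"
  have "d > 0" using assms unfolding d_def by (intro add_nonneg_pos) auto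
  moreover have "Im (of_real x * w / (1 - of_real x * w)) = x * Im w / d"
    by (simp add: Im_divide d_def algebra_simps)
  moreover have "0 < Im w * Im w" using assms by (simp add: zero_less_mult_iff) linarith
  ultimately show "Im w * Im (of_real x * w / (1 - of_real x * w)) > 0"
    using assms by (simp add: mult.left_commute)
qed

text \<open>The second factor in \<open>poly_theta_rootprod\<close> has no zero off the positive axis: each summand
  in it has an imaginary part of the sign of \<open>Im w\<close> if \<open>w\<close> is not real, and is at most \<open>0\<close> if
  \<open>w \<le> 0\<close>.\<close>

lemma theta_rootprod:
  assumes X: "\<forall>x\<in>set X. 0 < x"
  shows "\<exists>Y. (\<forall>y\<in>set Y. 0 < y) \<and> theta (rootprod X) = rootprod Y"
proof (rule exists_rootprod)
  show "coeff (theta (rootprod X)) 0 = 1"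
    unfolding coeff_theta newton_rootprod by simp
  fix w assume w: "poly (theta (rootprod X)) w = 0"
  show "\<exists>r>0. w = of_real r"
  proof (cases "poly (rootprod X) w = 0")
    case True
    then obtain x where x: "x \<in> set X" "of_real x * w = 1" unfolding poly_rootprod_eq_0 by blast
    with X have "x > 0" by blast
    with x show ?thesis by (intro exI[of _ "1 / x"]) (auto simp: field_simps)
  next
    case False
    define S where "S X = (\<Sum>x\<leftarrow>X. of_real x * w / (1 - of_real x * w))" for X
    have S: "1 - 2 * S X = 0"
      using w False poly_theta_rootprod[of X w] poly_rootprod_eq_0[of X w] by (simp add: S_def)
    have "Im w * Im (S X) \<ge> 0 \<and> (X \<noteq> [] \<longrightarrow> Im w * Im (S X) > 0)" if "Im w \<noteq> 0"
      using X
    proof (induction X)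
      case (Cons x X)
      then show ?case using Im_moebius(2)[OF that, of x]
        by (auto simp: S_def distrib_left intro: add_pos_nonneg)
    qed (simp add: S_def)
    moreover have "Im (S X) = 0" "Re (S X) = 1 / 2"
      using S by (auto simp: complex_eq_iff)
    moreover have "X \<noteq> []" using S by (auto simp: S_def)
    ultimately have re: "w = of_real (Re w)" by (auto simp: complex_eq_iff)
    have "Re (S X) \<le> 0" if "Re w \<le> 0"
      using X
    proof (induction X)
      case (Cons x X)
      have "x * Re w / (1 - x * Re w) \<le> 0"
        using that Cons.prems by (intro divide_nonpos_pos) (auto simp: mult_nonneg_nonpos add_pos_nonneg diff_gt_0_iff_gt intro: le_less_trans[of _ 0])
      moreover have "Re (of_real x * w / (1 - of_real x * w)) = x * Re w / (1 - x * Re w)"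
        by (subst (1 2) re) (metis Re_complex_of_real of_real_1 of_real_diff of_real_divide of_real_mult)
      ultimately show ?case using Cons by (simp add: S_def)
    qed (simp add: S_def)
    then have "Re w > 0" using \<open>Re (S X) = 1 / 2\<close> by linarith
    then show ?thesis using re by blast
  qed
qed

lemma Re_theta_rootprod_ge:
  assumes "\<forall>x\<in>set X. 0 < x \<and> x * norm w < 1"
  shows "Re (poly (theta (rootprod X)) (of_real (norm w)) / poly (rootprod X) (of_real (norm w)))
    \<le> Re (poly (theta (rootprod X)) w / poly (rootprod X) w)"
proof -
  have ne: "\<forall>x\<in>set X. of_real x * v \<noteq> 1" if "norm v = norm w" for v :: complex
  proof
    fix x assume "x \<in> set X"
    with assms have "0 < x" "x * norm w < 1" by auto
    then have "norm (of_real x * v) < 1" using that by (simp add: norm_mult)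
    then show "of_real x * v \<noteq> 1" by auto
  qed
  define S where "S v X = (\<Sum>x\<leftarrow>X. of_real x * v / (1 - of_real x * v))" for v :: complex and X
  have quot: "poly (theta (rootprod X)) v / poly (rootprod X) v = 1 - 2 * S v X"
    if "norm v = norm w" for v
    using poly_theta_rootprod[OF ne[OF that]] ne[OF that] poly_rootprod_eq_0[of X v]
    by (simp add: S_def)
  have "Re (S w X) \<le> Re (S (of_real (norm w)) X)"
    using assms
  proof (induction X)
    case (Cons x X)
    have "norm (1 - of_real x * w) \<ge> 1 - x * norm w"
      using norm_triangle_ineq2[of 1 "of_real x * w"] Cons.prems by (simp add: norm_mult)
    moreover have "0 < 1 - x * norm w" using Cons.prems by simp
    ultimately have "norm (of_real x * w / (1 - of_real x * w)) \<le> x * norm w / (1 - x * norm w)"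
      using Cons.prems unfolding norm_divide norm_mult
      by (intro frac_le mult_mono) auto
    then have "Re (of_real x * w / (1 - of_real x * w)) \<le> x * norm w / (1 - x * norm w)"
      using complex_Re_le_cmod order_trans by blast
    also have "\<dots> = Re (of_real x * of_real (norm w) / (1 - of_real x * of_real (norm w)))"
      by (metis Re_complex_of_real of_real_1 of_real_diff of_real_divide of_real_mult)
    finally show ?case using Cons by (simp add: S_def)
  qed (simp add: S_def)
  then show ?thesis by (simp add: quot)
qed

section \<open>Alternating power series and termwise limits\<close>

definition alt_series :: "(nat \<Rightarrow> real) \<Rightarrow> 'a \<Rightarrow> 'a::{real_normed_field,banach}" where
  "alt_series e w = (\<Sum>n. of_real ((-1) ^ n * e n) * w ^ n)"

definition entire_coeffs :: "(nat \<Rightarrow> real) \<Rightarrow> bool" where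
  "entire_coeffs e \<longleftrightarrow> (\<forall>n. 0 \<le> e n) \<and> (\<forall>r. summable (\<lambda>n. e n * r ^ n))"

definition theta_coeffs :: "(nat \<Rightarrow> real) \<Rightarrow> nat \<Rightarrow> real" where
  "theta_coeffs e n = real (2 * n + 1) * e n"

lemma alt_series_summable_norm:
  assumes "entire_coeffs e"
  shows "summable (\<lambda>n. norm (of_real ((-1) ^ n * e n) * w ^ n :: 'a::{real_normed_field,banach}))"
proof -
  have "norm (of_real ((-1) ^ n * e n) * w ^ n) = e n * norm w ^ n" for n
    using assms by (simp add: norm_mult norm_power entire_coeffs_def abs_mult)
  then show ?thesis using assms by (simp add: entire_coeffs_def)
qed

lemmas alt_series_summable = summable_norm_cancel[OF alt_series_summable_norm]

lemma alt_series_of_real: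
  assumes "entire_coeffs e"
  shows "alt_series e (of_real x :: 'a::{real_normed_field,banach}) = of_real (alt_series e x)"
  unfolding alt_series_def
  using suminf_of_real[OF alt_series_summable[OF assms, of x], where 'a = 'a] by simp

lemma entire_coeffs_theta:
  assumes "entire_coeffs e"
  shows "entire_coeffs (theta_coeffs e)"
  unfolding entire_coeffs_def
proof safe
  show "0 \<le> theta_coeffs e n" for n
    using assms by (simp add: theta_coeffs_def entire_coeffs_def)
  have le: "real (2 * n + 1) \<le> 3 ^ n" for n by (induction n) auto
  show "summable (\<lambda>n. theta_coeffs e n * r ^ n)" for r
  proof (rule summable_comparison_test')
    show "summable (\<lambda>n. e n * (3 * \<bar>r\<bar>) ^ n)" using assms unfolding entire_coeffs_def by blast
    show "norm (theta_coeffs e n * r ^ n) \<le> e n * (3 * \<bar>r\<bar>) ^ n" for n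
      using assms mult_right_mono[OF le, of "e n * \<bar>r\<bar> ^ n" n]
      by (simp add: theta_coeffs_def entire_coeffs_def norm_mult norm_power power_mult_distrib
          abs_mult power_abs mult_ac)
  qed
qed

lemma alt_series_differentiable:
  assumes "entire_coeffs e"
  shows "\<exists>D. (alt_series e has_field_derivative D) (at (w :: 'a::{real_normed_field,banach}))"
  using termdiffs_strong_converges_everywhere[OF alt_series_summable[OF assms]]
  unfolding alt_series_def [abs_def] by blast

lemma isCont_alt_series:
  assumes "entire_coeffs e"
  shows "isCont (alt_series e) (w :: 'a::{real_normed_field,banach})"
  using alt_series_differentiable[OF assms] DERIV_isCont by blast

lemma alt_series_0: "alt_series e 0 = of_real (e 0)"
  unfolding alt_series_def by (subst suminf_finite[of "{0}"]) (auto simp: power_0_left)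

lemma alt_series_odd_deriv:
  assumes "entire_coeffs e"
  shows "((\<lambda>z. z * alt_series e (z\<^sup>2)) has_field_derivative alt_series (theta_coeffs e) (z\<^sup>2))
    (at (z :: 'a::{real_normed_field,banach}))"
proof -
  define c :: "nat \<Rightarrow> 'a" where "c n = of_real ((-1) ^ n * e n)" for n
  have smb: "summable (\<lambda>n. c n * y ^ n)" for y
    unfolding c_def by (rule alt_series_summable[OF assms])
  define D where "D w = (\<Sum>n. diffs c n * w ^ n)" for w
  have D: "(alt_series e has_field_derivative D w) (at w)" for w
    unfolding D_def alt_series_def [abs_def] c_def[symmetric]
    by (rule termdiffs_strong_converges_everywhere[OF smb])
  have "summable (\<lambda>n. diffs c n * w ^ n)" for w
    using termdiff_converges_all[OF smb] .
  then have "(\<lambda>n. of_nat n * c n * w ^ (n - Suc 0)) sums D w" for w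
    unfolding D_def by (rule diffs_equiv)
  then have "(\<lambda>n. 2 * w * (of_nat n * c n * w ^ (n - Suc 0))) sums (2 * w * D w)" for w
    by (rule sums_mult)
  moreover have "2 * w * (of_nat n * c n * w ^ (n - Suc 0)) = of_nat (2 * n) * (c n * w ^ n)" for n w
    by (cases n) (auto simp: algebra_simps)
  ultimately have D2: "(\<lambda>n. of_nat (2 * n) * (c n * w ^ n)) sums (2 * w * D w)" for w by simp
  have "(\<lambda>n. c n * w ^ n) sums alt_series e w" for w
    unfolding alt_series_def c_def by (rule summable_sums[OF alt_series_summable[OF assms]])
  with D2 have "(\<lambda>n. of_nat (2 * n) * (c n * w ^ n) + c n * w ^ n) sums (2 * w * D w + alt_series e w)"
    for w
    by (rule sums_add)
  moreover have "of_nat (2 * n) * (c n * w ^ n) + c n * w ^ n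
      = of_real ((-1) ^ n * theta_coeffs e n) * w ^ n" for n w
    by (simp add: c_def theta_coeffs_def algebra_simps)
  ultimately have th: "alt_series (theta_coeffs e) w = 2 * w * D w + alt_series e w" for w
    unfolding alt_series_def[of "theta_coeffs e"] by (simp add: sums_iff)
  have "((\<lambda>z. z * alt_series e (z\<^sup>2)) has_field_derivative
      1 * alt_series e (z\<^sup>2) + D (z\<^sup>2) * (2 * z) * z) (at z)"
    by (rule DERIV_mult[OF DERIV_ident DERIV_chain2[OF D]]) (auto intro!: derivative_eq_intros)
  then show ?thesis unfolding th by (simp add: power2_eq_square mult_ac add_ac)
qed

section \<open>Limits of polynomials with positive zeros\<close>

text \<open>Domination of the coefficients turns their convergence into uniform convergence on discs.
  The limits belong to the Laguerre-Polya class. Keeping the approximating polynomials, instead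
  of the zeros of the limit, makes a Hadamard factorization unnecessary: a statement about finite
  products passes to the limit as soon as it is expressed by values or by coefficients.\<close>

definition root_limit :: "(nat \<Rightarrow> real) \<Rightarrow> (nat \<Rightarrow> real list) \<Rightarrow> bool" where
  "root_limit e X \<longleftrightarrow> entire_coeffs e \<and> (\<forall>N. \<forall>x\<in>set (X N). 0 < x) \<and>
     (\<forall>N n. norm (coeff (rootprod (X N)) n) \<le> e n) \<and>
     (\<forall>n. (\<lambda>N. coeff (rootprod (X N)) n) \<longlonglongrightarrow> of_real ((-1) ^ n * e n))"

lemma root_limitD:
  assumes "root_limit e X"
  shows "entire_coeffs e" "\<forall>x\<in>set (X N). 0 < x" "norm (coeff (rootprod (X N)) n) \<le> e n"
    "(\<lambda>N. coeff (rootprod (X N)) n) \<longlonglongrightarrow> of_real ((-1) ^ n * e n)"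
  using assms unfolding root_limit_def by blast+

lemma root_limit_theta:
  assumes "root_limit e X"
  obtains Y where "root_limit (theta_coeffs e) Y" "\<And>N. rootprod (Y N) = theta (rootprod (X N))"
proof -
  have "\<forall>N. \<exists>Y. (\<forall>y\<in>set Y. 0 < y) \<and> theta (rootprod (X N)) = rootprod Y"
    using theta_rootprod root_limitD(2)[OF assms] by blast
  then obtain Y where Y: "\<And>N. \<forall>y\<in>set (Y N). 0 < y" "\<And>N. rootprod (Y N) = theta (rootprod (X N))"
    by metis
  have "root_limit (theta_coeffs e) Y"
    unfolding root_limit_def
  proof (intro conjI allI)
    show "entire_coeffs (theta_coeffs e)" using entire_coeffs_theta root_limitD(1)[OF assms] .
    show "\<forall>x\<in>set (Y N). 0 < x" for N by (rule Y)
    show "norm (coeff (rootprod (Y N)) n) \<le> theta_coeffs e n" for N n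
      unfolding Y coeff_theta theta_coeffs_def norm_mult norm_of_nat
      by (intro mult_left_mono root_limitD(3)[OF assms]) auto
    show "(\<lambda>N. coeff (rootprod (Y N)) n) \<longlonglongrightarrow> of_real ((-1) ^ n * theta_coeffs e n)" for n
      using tendsto_mult_left[OF root_limitD(4)[OF assms, of n], of "of_nat (2 * n + 1)"]
      unfolding Y coeff_theta theta_coeffs_def by (simp add: mult_ac)
  qed
  then show thesis using Y that by blast
qed

lemma root_limit_uniform:
  assumes "root_limit e X" "0 \<le> R" "0 < \<epsilon>"
  shows "\<forall>\<^sub>F N in sequentially. \<forall>w. norm w \<le> R \<longrightarrow>
    norm (poly (rootprod (X N)) w - alt_series e w) < \<epsilon>"
proof -
  define c :: "nat \<Rightarrow> complex" where "c n = of_real ((-1) ^ n * e n)" for n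
  define a where "a n N = norm (coeff (rootprod (X N)) n - c n) * R ^ n" for n N
  note D = root_limitD[OF assms(1)]
  have e0: "0 \<le> e n" for n using D(1) by (simp add: entire_coeffs_def)
  have cn: "norm (c n) = e n" for n using e0[of n] by (simp add: c_def norm_mult norm_power abs_mult)
  have an: "0 \<le> a n N" "a n N \<le> 2 * (e n * R ^ n)" for n N
  proof -
    have "norm (coeff (rootprod (X N)) n - c n) \<le> e n + e n"
      using norm_triangle_ineq4[of "coeff (rootprod (X N)) n" "c n"] D(3)[of N n] cn[of n] by linarith
    then have "a n N \<le> (e n + e n) * R ^ n"
      unfolding a_def using assms(2) by (intro mult_right_mono) auto
    then show "a n N \<le> 2 * (e n * R ^ n)" by simp
    show "0 \<le> a n N" using assms(2) by (simp add: a_def)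
  qed
  have M: "summable (\<lambda>n. 2 * (e n * R ^ n))"
    using D(1) by (intro summable_mult) (simp add: entire_coeffs_def)
  have as: "summable (\<lambda>n. a n N)" for N
    by (rule summable_comparison_test'[OF M, of 0]) (use an in auto)
  have "(\<lambda>N. \<Sum>n. a n N) \<longlonglongrightarrow> (\<Sum>n. 0)"
  proof (rule tannerys_theorem[THEN conjunct2, THEN conjunct2, OF _ _ M])
    show "(\<lambda>N. a n N) \<longlonglongrightarrow> 0" for n
      using tendsto_mult_right[OF tendsto_norm_zero[OF LIM_zero[OF D(4)[of n]]], of "R ^ n"]
      unfolding a_def c_def by simp
    show "\<forall>\<^sub>F (n, N) in sequentially \<times>\<^sub>F sequentially. norm (a n N) \<le> 2 * (e n * R ^ n)"
      by (rule always_eventually) (use an in auto)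
  qed simp
  then have "\<forall>\<^sub>F N in sequentially. (\<Sum>n. a n N) < \<epsilon>"
    using assms(3) by (auto dest: order_tendstoD(2))
  then show ?thesis
  proof eventually_elim
    case (elim N)
    show ?case
    proof safe
      fix w :: complex assume w: "norm w \<le> R"
      define b where "b n = coeff (rootprod (X N)) n * w ^ n - c n * w ^ n" for n
      have fin: "(\<lambda>n. coeff (rootprod (X N)) n * w ^ n) sums poly (rootprod (X N)) w"
        unfolding poly_altdef by (rule sums_finite) (auto simp: coeff_eq_0)
      have "(\<lambda>n. c n * w ^ n) sums alt_series e w"
        unfolding alt_series_def c_def by (rule summable_sums[OF alt_series_summable[OF D(1)]])
      with fin have "b sums (poly (rootprod (X N)) w - alt_series e w)"
        unfolding b_def by (rule sums_diff)
      then have eq: "poly (rootprod (X N)) w - alt_series e w = suminf b" by (simp add: sums_iff)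
      have ba: "norm (b n) \<le> a n N" for n
        unfolding b_def a_def left_diff_distrib[symmetric] norm_mult norm_power
        using w by (intro mult_left_mono power_mono) auto
      have "norm (suminf b) \<le> (\<Sum>n. a n N)"
        by (rule norm_suminf_le) (use ba as in auto)
      with elim eq show "norm (poly (rootprod (X N)) w - alt_series e w) < \<epsilon>" by simp
    qed
  qed
qed

lemma root_limit_tendsto:
  assumes "root_limit e X"
  shows "(\<lambda>N. poly (rootprod (X N)) w) \<longlonglongrightarrow> alt_series e w"
proof (rule tendstoI)
  fix \<epsilon> :: real assume "0 < \<epsilon>"
  from root_limit_uniform[OF assms norm_ge_zero this, of w]
  show "\<forall>\<^sub>F N in sequentially. dist (poly (rootprod (X N)) w) (alt_series e w) < \<epsilon>"
    by eventually_elim (simp add: dist_norm)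
qed

lemma root_limit_tendsto_real:
  assumes "root_limit e X"
  shows "(\<lambda>N. Re (poly (rootprod (X N)) (of_real r))) \<longlonglongrightarrow> alt_series e r"
  using tendsto_Re[OF root_limit_tendsto[OF assms, of "of_real r"]]
  by (simp add: alt_series_of_real[OF root_limitD(1)[OF assms]])

text \<open>Here uniform convergence is essential: signs at single points would not exclude a pair of
  close zeros of the polynomials, whereas the minimum of the modulus of the limit on the segment
  does.\<close>

lemma root_limit_zero_free:
  assumes lim: "root_limit e X" and R: "0 \<le> R" and nz: "\<And>s. 0 \<le> s \<Longrightarrow> s \<le> R \<Longrightarrow> alt_series e s \<noteq> 0"
  shows "\<forall>\<^sub>F N in sequentially. \<forall>x\<in>set (X N). 0 < x \<and> x * R < 1"
proof -
  note D = root_limitD[OF lim]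
  have "continuous_on {0..R} (\<lambda>s. \<bar>alt_series e s :: real\<bar>)"
    by (intro continuous_at_imp_continuous_on ballI continuous_intros isCont_alt_series[OF D(1)])
  then obtain t where t: "t \<in> {0..R}" "\<And>s. s \<in> {0..R} \<Longrightarrow> \<bar>alt_series e t :: real\<bar> \<le> \<bar>alt_series e s\<bar>"
    using continuous_attains_inf[of "{0..R}" "\<lambda>s. \<bar>alt_series e s :: real\<bar>"] R by auto
  have "0 < \<bar>alt_series e t :: real\<bar>" using nz t(1) by auto
  from root_limit_uniform[OF lim R this] show ?thesis
  proof eventually_elim
    case (elim N)
    show ?case
    proof
      fix x assume x: "x \<in> set (X N)"
      with D(2) have x0: "0 < x" by blast
      moreover have "x * R < 1"
      proof (rule ccontr)
        assume "\<not> x * R < 1"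
        then have s: "1 / x \<in> {0..R}" using x0 by (auto simp: field_simps)
        have "poly (rootprod (X N)) (of_real (1 / x)) = 0"
          unfolding poly_rootprod_eq_0 using x x0 by (intro bexI[of _ x]) auto
        moreover have "norm (poly (rootprod (X N)) (of_real (1 / x)) - alt_series e (of_real (1 / x)))
            < \<bar>alt_series e t :: real\<bar>"
          using elim s x0 by (auto simp: norm_divide)
        ultimately have "\<bar>alt_series e (1 / x)\<bar> < \<bar>alt_series e t :: real\<bar>"
          unfolding alt_series_of_real[OF D(1)] by simp
        with t(2)[OF s] show False by linarith
      qed
      ultimately show "0 < x \<and> x * R < 1" by blast
    qed
  qed
qed

text \<open>Inside the zero-free disc, the quotient that governs convexity is worst at the positive
  point of each circle.\<close>

lemma Re_theta_quotient_ge: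
  assumes lim: "root_limit e X" and nz: "\<And>s. 0 \<le> s \<Longrightarrow> s \<le> norm w \<Longrightarrow> alt_series e s \<noteq> (0::real)"
  shows "alt_series e w \<noteq> 0"
    and "alt_series (theta_coeffs e) (norm w) / alt_series e (norm w)
      \<le> Re (alt_series (theta_coeffs e) w / alt_series e w)"
proof -
  obtain Y where Y: "root_limit (theta_coeffs e) Y" "\<And>N. rootprod (Y N) = theta (rootprod (X N))"
    using root_limit_theta[OF lim] by blast
  have ev: "\<forall>\<^sub>F N in sequentially. \<forall>x\<in>set (X N). 0 < x \<and> x * norm w < 1"
    by (rule root_limit_zero_free[OF lim norm_ge_zero nz])
  have "0 \<le> alt_series e (norm w)"
    by (rule tendsto_lowerbound[OF root_limit_tendsto_real[OF lim]])
      (use ev in \<open>auto elim!: eventually_mono dest!: norm_rootprod_ge(2)\<close>)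
  then have pos: "0 < alt_series e (norm w)" using nz[of "norm w"] by simp
  have "alt_series e (norm w) \<le> norm (alt_series e w)"
    by (rule tendsto_le[OF _ tendsto_norm[OF root_limit_tendsto[OF lim]] root_limit_tendsto_real[OF lim]])
      (use ev in \<open>auto elim!: eventually_mono dest!: norm_rootprod_ge(1)\<close>)
  with pos show ne: "alt_series e w \<noteq> 0" by auto
  have lims: "(\<lambda>N. Re (poly (theta (rootprod (X N))) v / poly (rootprod (X N)) v))
      \<longlonglongrightarrow> Re (alt_series (theta_coeffs e) v / alt_series e v)" if "alt_series e v \<noteq> 0" for v
    by (intro tendsto_Re tendsto_divide root_limit_tendsto[OF lim] that
        root_limit_tendsto[OF Y(1), unfolded Y(2)])
  note real = alt_series_of_real[OF root_limitD(1)[OF lim]]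
    alt_series_of_real[OF root_limitD(1)[OF Y(1)]]
  have "Re (alt_series (theta_coeffs e) (of_real (norm w)) / alt_series e (of_real (norm w)))
      \<le> Re (alt_series (theta_coeffs e) w / alt_series e w)"
    by (rule tendsto_le[OF _ lims[OF ne] lims])
      (use ev pos in \<open>auto simp: real elim!: eventually_mono dest!: Re_theta_rootprod_ge\<close>)
  then show "alt_series (theta_coeffs e) (norm w) / alt_series e (norm w)
      \<le> Re (alt_series (theta_coeffs e) w / alt_series e w)"
    unfolding real by (simp flip: of_real_divide)
qed

text \<open>Newton's formulas for the sums of the squares and of the cubes of the reciprocal zeros, in
  terms of the coefficients.\<close>

definition psum2 :: "(nat \<Rightarrow> real) \<Rightarrow> real" where
  "psum2 e = (e 1)\<^sup>2 - 2 * e 2"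

definition psum3 :: "(nat \<Rightarrow> real) \<Rightarrow> real" where
  "psum3 e = e 1 ^ 3 - 3 * e 1 * e 2 + 3 * e 3"

lemma root_limit_powsum:
  assumes "root_limit e X"
  shows "(\<lambda>N. powsum 2 (X N)) \<longlonglongrightarrow> psum2 e" "(\<lambda>N. powsum 3 (X N)) \<longlonglongrightarrow> psum3 e"
proof -
  define c where "c n N = Re (coeff (rootprod (X N)) n)" for n N
  have c: "(\<lambda>N. c n N) \<longlonglongrightarrow> (-1) ^ n * e n" for n
    using tendsto_Re[OF root_limitD(4)[OF assms, of n]] by (simp add: c_def)
  have p1: "powsum 1 (X N) = - c 1 N" for N
    using newton_rootprod(2)[of "X N"] by (simp add: c_def)
  have p2: "powsum 2 (X N) = (c 1 N)\<^sup>2 - 2 * c 2 N" for N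
    using arg_cong[OF newton_rootprod(3)[of "X N"], of Re] p1[of N] by (simp add: c_def)
  have p3: "powsum 3 (X N) = (powsum 1 (X N) * (3 * powsum 2 (X N) - (powsum 1 (X N))\<^sup>2) - 6 * c 3 N) / 2"
    for N
    using arg_cong[OF newton_rootprod(4)[of "X N"], of Re]
    by (simp add: c_def power2_eq_square power3_eq_cube algebra_simps)
  have l1: "(\<lambda>N. powsum 1 (X N)) \<longlonglongrightarrow> e 1"
    unfolding p1 using tendsto_minus[OF c[of 1]] by simp
  have "(\<lambda>N. powsum 2 (X N)) \<longlonglongrightarrow> ((-1) ^ 1 * e 1)\<^sup>2 - 2 * ((-1) ^ 2 * e 2)"
    unfolding p2 by (intro tendsto_intros c)
  then show l2: "(\<lambda>N. powsum 2 (X N)) \<longlonglongrightarrow> psum2 e" by (simp add: psum2_def)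
  have "(\<lambda>N. powsum 3 (X N)) \<longlonglongrightarrow> (e 1 * (3 * psum2 e - (e 1)\<^sup>2) - 6 * ((-1) ^ 3 * e 3)) / 2"
    unfolding p3 by (intro tendsto_intros c l1 l2) simp
  also have "(e 1 * (3 * psum2 e - (e 1)\<^sup>2) - 6 * ((-1) ^ 3 * e 3)) / 2 = psum3 e"
    by (simp add: psum2_def psum3_def power2_eq_square power3_eq_cube field_simps)
  finally show "(\<lambda>N. powsum 3 (X N)) \<longlonglongrightarrow> psum3 e" .
qed

text \<open>The two halves of the Euler-Rayleigh estimate. For a polynomial with largest reciprocal zero
  \<open>x\<^sub>1\<close> they are \<open>\<Sum> x\<^sup>3 \<le> x\<^sub>1 \<Sum> x\<^sup>2\<close> and \<open>x\<^sub>1\<^sup>3 \<le> \<Sum> x\<^sup>3\<close>. The second one is applied in the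
  form of \<open>rootprod_lower_bound\<close>, which gives a lower bound for the values of the limit
  directly.\<close>

lemma zero_free_imp_psum_le:
  assumes "root_limit e X" "0 \<le> M" "\<And>s. 0 \<le> s \<Longrightarrow> s \<le> M \<Longrightarrow> alt_series e s \<noteq> (0::real)"
  shows "M * psum3 e \<le> psum2 e"
proof (rule tendsto_le[OF _ root_limit_powsum(1)[OF assms(1)]
      tendsto_mult_left[OF root_limit_powsum(2)[OF assms(1)]]])
  have "\<forall>\<^sub>F N in sequentially. \<forall>x\<in>set (X N). 0 < x \<and> x * M < 1"
    by (rule root_limit_zero_free[OF assms])
  then show "\<forall>\<^sub>F N in sequentially. M * powsum 3 (X N) \<le> powsum 2 (X N)"
    by eventually_elim (use powsum_Suc_le[of _ M 2] in \<open>simp add: mult.commute less_imp_le\<close>)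
qed simp

lemma zero_imp_psum3_ge:
  assumes "root_limit e X" "0 \<le> w" "alt_series e w = (0::real)"
  shows "1 \<le> w ^ 3 * psum3 e"
proof (rule ccontr)
  assume "\<not> ?thesis"
  then have lt: "w ^ 3 * psum3 e < 1" by simp
  note lim3 = tendsto_mult_left[OF root_limit_powsum(2)[OF assms(1)], of "w ^ 3"]
  have "1 - w ^ 3 * psum3 e \<le> alt_series e w * (alt_series e (- w))\<^sup>2"
  proof (rule tendsto_le)
    show "(\<lambda>N. Re (poly (rootprod (X N)) (of_real w)) * (Re (poly (rootprod (X N)) (of_real (- w))))\<^sup>2)
        \<longlonglongrightarrow> alt_series e w * (alt_series e (- w))\<^sup>2"
      by (intro tendsto_intros root_limit_tendsto_real[OF assms(1)])
    show "(\<lambda>N. 1 - w ^ 3 * powsum 3 (X N)) \<longlonglongrightarrow> 1 - w ^ 3 * psum3 e"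
      by (intro tendsto_intros lim3)
    from order_tendstoD(2)[OF lim3 lt]
    show "\<forall>\<^sub>F N in sequentially. 1 - w ^ 3 * powsum 3 (X N)
        \<le> Re (poly (rootprod (X N)) (of_real w)) * (Re (poly (rootprod (X N)) (of_real (- w))))\<^sup>2"
      by eventually_elim (rule rootprod_lower_bound[OF root_limitD(2)[OF assms(1)] assms(2)])
  qed simp
  with assms(3) lt show False by simp
qed

section \<open>The Bessel series as a limit of q-Lommel polynomials\<close>

text \<open>With \<open>\<beta> = q powr (\<nu> + 1)\<close> these are the moduli of the coefficients of the normalized Bessel
  function. The parameter \<open>\<beta>\<close> is free because the recurrence shifts it.\<close>

definition bessel_coeff :: "real \<Rightarrow> real \<Rightarrow> nat \<Rightarrow> real" where
  "bessel_coeff q \<beta> n = q ^ (n * (n - 1)) * \<beta> ^ n / (4 ^ n * qpoch q q n * qpoch \<beta> q n)"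

definition lommel_step :: "real \<Rightarrow> real \<Rightarrow> real" where
  "lommel_step q \<beta> = \<beta> / (4 * (1 - \<beta>) * (1 - \<beta> * q))"

lemma qpoch_0 [simp]: "qpoch a q 0 = 1"
  by (simp add: qpoch_def)

lemma bessel_coeff_0 [simp]: "bessel_coeff q \<beta> 0 = 1"
  by (simp add: bessel_coeff_def)

lemma qpoch_Suc_shift: "qpoch a q (Suc n) = (1 - a) * qpoch (a * q) q n"
  by (induction n) (simp_all add: qpoch_Suc mult.assoc)

lemma mult_power_unit:
  assumes "0 < q" "q < 1" "0 < \<beta>" "\<beta> < (1::real)"
  shows "0 < \<beta> * q ^ n" "\<beta> * q ^ n < 1"
  using qfactor_pos[OF assms(3,4,1,2), of n] assms by auto

lemma lommel_step_pos:
  assumes "0 < q" "q < 1" "0 < \<beta>" "\<beta> < 1"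
  shows "0 < lommel_step q \<beta>"
  using mult_power_unit[OF assms, of 1] assms by (simp add: lommel_step_def)

lemma bessel_coeff_pos:
  assumes "0 < q" "q < 1" "0 < \<beta>" "\<beta> < 1"
  shows "0 < bessel_coeff q \<beta> n"
  using qpoch_pos[of q q n] qpoch_pos[of \<beta> q n] assms by (simp add: bessel_coeff_def)

text \<open>The three-term recurrence of the Bessel functions in the order: raising \<open>\<nu>\<close> by one
  multiplies \<open>\<beta>\<close> by \<open>q\<close>.\<close>

lemma bessel_coeff_recurrence:
  assumes q: "0 < q" "q < 1" and b: "0 < \<beta>" "\<beta> < 1"
  shows "bessel_coeff q \<beta> (Suc n)
    = bessel_coeff q (\<beta> * q) (Suc n) + lommel_step q \<beta> * bessel_coeff q (\<beta> * q\<^sup>2) n"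
proof -
  define Q R y where "Q = qpoch q q n" and "R = qpoch (\<beta> * q\<^sup>2) q n" and "y = q ^ Suc n"
  define K where "K = q ^ (n * (n + 1)) * \<beta> ^ Suc n / (4 ^ Suc n * Q * R * (1 - \<beta> * q))"
  have bq: "0 < 1 - \<beta> * q" "0 < 1 - \<beta> * y" "0 < 1 - y"
    using mult_power_unit[OF q b, of 1] mult_power_unit[OF q b, of "Suc n"]
      mult_power_unit[OF q q, of n] by (simp_all add: y_def)
  have pos: "0 < Q" "0 < R"
    using qpoch_pos[OF q q, of n] qpoch_pos[of "\<beta> * q\<^sup>2" q n] mult_power_unit[OF q b, of 2] q
    by (simp_all add: Q_def R_def)
  have r1: "qpoch (\<beta> * q) q (Suc n) = (1 - \<beta> * q) * R"
    unfolding qpoch_Suc_shift R_def by (simp add: power2_eq_square mult.assoc)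
  moreover have "qpoch (\<beta> * q) q (Suc n) = qpoch (\<beta> * q) q n * (1 - \<beta> * y)"
    unfolding qpoch_Suc y_def by (simp add: mult.assoc)
  ultimately have "qpoch (\<beta> * q) q n = (1 - \<beta> * q) * R / (1 - \<beta> * y)"
    using bq by (simp add: field_simps)
  then have r2: "qpoch \<beta> q (Suc n) = (1 - \<beta>) * ((1 - \<beta> * q) * R / (1 - \<beta> * y))"
    by (simp add: qpoch_Suc_shift)
  have r3: "qpoch q q (Suc n) = Q * (1 - y)" by (simp add: qpoch_Suc Q_def y_def)
  have y0: "(\<beta> * q) ^ Suc n = \<beta> ^ Suc n * y" by (simp add: y_def power_mult_distrib)
  have y2: "q ^ (n * (n - 1)) * (\<beta> * q\<^sup>2) ^ n = q ^ (n * (n + 1)) * \<beta> ^ n"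
  proof -
    have "q ^ (n * (n - 1)) * q ^ (2 * n) = q ^ (n * (n - 1) + 2 * n)" by (simp add: power_add)
    also have "n * (n - 1) + 2 * n = n * (n + 1)" by (cases n) auto
    finally show ?thesis by (simp add: power_mult_distrib power_mult[symmetric] mult_ac)
  qed
  have "bessel_coeff q \<beta> (Suc n) = K * ((1 - \<beta> * y) / ((1 - y) * (1 - \<beta>)))"
    unfolding bessel_coeff_def r2 r3 K_def by (simp add: mult_ac)
  also have "(1 - \<beta> * y) / ((1 - y) * (1 - \<beta>)) = y / (1 - y) + 1 / (1 - \<beta>)"
    using bq b by (simp add: field_simps)
  also have "K * (y / (1 - y) + 1 / (1 - \<beta>)) = K * y / (1 - y) + K / (1 - \<beta>)"
    by (simp add: distrib_left)
  also have "K * y / (1 - y) = bessel_coeff q (\<beta> * q) (Suc n)"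
    unfolding bessel_coeff_def r1 r3 y0 K_def by (simp add: mult_ac)
  also have "K / (1 - \<beta>) = lommel_step q \<beta> * bessel_coeff q (\<beta> * q\<^sup>2) n"
    unfolding bessel_coeff_def y2 Q_def[symmetric] R_def[symmetric] lommel_step_def K_def
    by (simp add: mult_ac)
  finally show ?thesis .
qed

lemma bessel_coeff_vanishes:
  assumes q: "0 < q" "q < 1"
  shows "(\<lambda>k. bessel_coeff q (\<beta> * q ^ k) (Suc n)) \<longlonglongrightarrow> 0"
proof -
  have b: "(\<lambda>k. \<beta> * q ^ k) \<longlonglongrightarrow> 0"
    using tendsto_mult_left[OF LIMSEQ_realpow_zero[of q], of \<beta>] q by simp
  have "(\<lambda>k. bessel_coeff q (\<beta> * q ^ k) (Suc n)) \<longlonglongrightarrow>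
      q ^ (Suc n * (Suc n - 1)) * 0 ^ Suc n
        / (4 ^ Suc n * qpoch q q (Suc n) * (\<Prod>k=1..Suc n. 1 - 0 * q ^ (k - 1)))"
    unfolding bessel_coeff_def qpoch_def[of "_ * _"]
    using qpoch_pos[OF q q, of "Suc n"] by (intro tendsto_intros tendsto_prod b) auto
  then show ?thesis by simp
qed

text \<open>The recurrence, started with two constants at the order \<open>\<nu> + N\<close> and run down to \<open>\<nu>\<close>.\<close>

fun lommel_coeff :: "real \<Rightarrow> nat \<Rightarrow> real \<Rightarrow> nat \<Rightarrow> real" where
  "lommel_coeff q 0 \<beta> n = (if n = 0 then 1 else 0)"
| "lommel_coeff q (Suc 0) \<beta> n = (if n = 0 then 1 else 0)"
| "lommel_coeff q (Suc (Suc N)) \<beta> n = lommel_coeff q (Suc N) (\<beta> * q) n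
     + (case n of 0 \<Rightarrow> 0 | Suc m \<Rightarrow> lommel_step q \<beta> * lommel_coeff q N (\<beta> * q\<^sup>2) m)"

fun lommel :: "real \<Rightarrow> nat \<Rightarrow> real \<Rightarrow> complex poly" where
  "lommel q 0 \<beta> = 1"
| "lommel q (Suc 0) \<beta> = 1"
| "lommel q (Suc (Suc N)) \<beta>
     = lommel q (Suc N) (\<beta> * q) - smult (of_real (lommel_step q \<beta>)) (pCons 0 (lommel q N (\<beta> * q\<^sup>2)))"

lemma coeff_lommel: "coeff (lommel q N \<beta>) n = of_real ((-1) ^ n * lommel_coeff q N \<beta> n)"
  by (induction q N \<beta> n rule: lommel_coeff.induct)
    (auto simp: algebra_simps split: nat.splits)

lemma shift_unit:
  assumes "0 < q" "q < 1" "0 < \<beta>" "\<beta> < (1::real)"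
  shows "0 < \<beta> * q" "\<beta> * q < 1" "0 < \<beta> * q\<^sup>2" "\<beta> * q\<^sup>2 < 1"
  using mult_power_unit[OF assms, of 1] mult_power_unit[OF assms, of 2] by auto

lemma lommel_coeff_bounds:
  assumes "0 < q" "q < 1" "0 < \<beta>" "\<beta> < 1"
  shows "0 \<le> lommel_coeff q N \<beta> n \<and> lommel_coeff q N \<beta> n \<le> bessel_coeff q \<beta> n"
  using assms
proof (induction q N \<beta> n rule: lommel_coeff.induct)
  case (3 q N \<beta> n)
  note q = "3.prems" and s = shift_unit[OF "3.prems"]
  have IH1: "0 \<le> lommel_coeff q (Suc N) (\<beta> * q) n \<and>
      lommel_coeff q (Suc N) (\<beta> * q) n \<le> bessel_coeff q (\<beta> * q) n"
    using 3 s by blast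
  show ?case
  proof (cases n)
    case (Suc m)
    have IH2: "0 \<le> lommel_coeff q N (\<beta> * q\<^sup>2) m \<and>
        lommel_coeff q N (\<beta> * q\<^sup>2) m \<le> bessel_coeff q (\<beta> * q\<^sup>2) m"
      using 3 s Suc by blast
    show ?thesis
      using IH1 IH2 lommel_step_pos[OF q] unfolding Suc bessel_coeff_recurrence[OF q]
      by (auto intro!: add_mono mult_left_mono add_nonneg_nonneg)
  qed (use IH1 in auto)
qed (auto simp: less_imp_le[OF bessel_coeff_pos])

lemma lommel_coeff_mono:
  assumes "0 < q" "q < 1" "0 < \<beta>" "\<beta> < 1"
  shows "lommel_coeff q N \<beta> n \<le> lommel_coeff q (Suc N) \<beta> n"
  using assms
proof (induction q N \<beta> n rule: lommel_coeff.induct)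
  case (2 q \<beta> n)
  then show ?case using lommel_step_pos[OF 2] by (auto split: nat.splits)
next
  case (3 q N \<beta> n)
  note s = shift_unit[OF "3.prems"]
  show ?case using 3 s lommel_step_pos[OF "3.prems"]
    by (auto split: nat.splits intro!: add_mono mult_left_mono simp del: lommel_coeff.simps(1,2))
qed auto

text \<open>The coefficients increase with \<open>N\<close>, so they converge. The defect \<open>g \<beta>\<close> of the limit
  satisfies \<open>g \<beta> = g (\<beta> * q)\<close>, hence \<open>g \<beta> = g (\<beta> * q ^ k)\<close>, which tends to \<open>0\<close>.\<close>

lemma lommel_coeff_tendsto:
  assumes "0 < q" "q < 1" "0 < \<beta>" "\<beta> < 1"
  shows "(\<lambda>N. lommel_coeff q N \<beta> n) \<longlonglongrightarrow> bessel_coeff q \<beta> n"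
  using assms
proof (induction n arbitrary: \<beta>)
  case 0
  have "lommel_coeff q N \<beta> 0 = 1" for N
    by (induction q N \<beta> "0::nat" rule: lommel_coeff.induct) auto
  then show ?case by simp
next
  case (Suc n)
  note q = Suc.prems(1,2)
  define L where "L \<beta> = lim (\<lambda>N. lommel_coeff q N \<beta> (Suc n))" for \<beta>
  have L: "(\<lambda>N. lommel_coeff q N \<beta> (Suc n)) \<longlonglongrightarrow> L \<beta>" if b: "0 < \<beta>" "\<beta> < 1" for \<beta>
  proof -
    have "incseq (\<lambda>N. lommel_coeff q N \<beta> (Suc n))"
      by (rule incseq_SucI) (rule lommel_coeff_mono[OF q b])
    then obtain l where "(\<lambda>N. lommel_coeff q N \<beta> (Suc n)) \<longlonglongrightarrow> l"
      using lommel_coeff_bounds[OF q b] by (metis incseq_convergent)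
    then show ?thesis unfolding L_def by (simp add: limI)
  qed
  define g where "g \<beta> = bessel_coeff q \<beta> (Suc n) - L \<beta>" for \<beta>
  have L0: "0 \<le> L \<beta>" and g0: "0 \<le> g \<beta>" if b: "0 < \<beta>" "\<beta> < 1" for \<beta>
    using LIMSEQ_le_const[OF L[OF b], of 0] LIMSEQ_le_const2[OF L[OF b]] lommel_coeff_bounds[OF q b]
    unfolding g_def by auto
  have step: "g \<beta> = g (\<beta> * q)" if b: "0 < \<beta>" "\<beta> < 1" for \<beta>
  proof -
    note s = shift_unit[OF q b]
    have "(\<lambda>N. lommel_coeff q (Suc (Suc N)) \<beta> (Suc n)) \<longlonglongrightarrow>
        L (\<beta> * q) + lommel_step q \<beta> * bessel_coeff q (\<beta> * q\<^sup>2) n"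
      using LIMSEQ_Suc[OF L[OF s(1,2)]] Suc.IH[OF q s(3,4)] by (auto intro!: tendsto_intros)
    moreover have "(\<lambda>N. lommel_coeff q (Suc (Suc N)) \<beta> (Suc n)) \<longlonglongrightarrow> L \<beta>"
      using LIMSEQ_Suc[OF LIMSEQ_Suc[OF L[OF b]]] .
    ultimately have "L \<beta> = L (\<beta> * q) + lommel_step q \<beta> * bessel_coeff q (\<beta> * q\<^sup>2) n"
      using LIMSEQ_unique by blast
    then show ?thesis unfolding g_def bessel_coeff_recurrence[OF q b] by simp
  qed
  have gk: "g \<beta> = g (\<beta> * q ^ k)" for k
  proof (induction k)
    case (Suc k)
    then show ?case
      using step[OF mult_power_unit[OF q \<open>0 < \<beta>\<close> \<open>\<beta> < 1\<close>, of k]] by (simp add: mult_ac)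
  qed simp
  have "g \<beta> \<le> bessel_coeff q (\<beta> * q ^ k) (Suc n)" for k
    using gk[of k] L0[OF mult_power_unit[OF q Suc.prems(3,4), of k]] by (simp add: g_def)
  then have "g \<beta> \<le> 0"
    using LIMSEQ_le_const[OF bessel_coeff_vanishes[OF q, of \<beta> n], of "g \<beta>"] by blast
  then have "L \<beta> = bessel_coeff q \<beta> (Suc n)" using g0[OF Suc.prems(3,4)] by (simp add: g_def)
  then show ?case using L[OF Suc.prems(3,4)] by simp
qed

text \<open>A discrete Christoffel-Darboux argument: multiplying the recurrence by the conjugate of its
  middle term relates the imaginary parts of \<open>P N \<beta>\<close> and of \<open>cnj w * P N \<beta>\<close> at consecutive
  indices, so that their signs propagate. The strict inequality prevents a nonreal zero.\<close>

lemma lommel_Im: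
  assumes "0 < q" "q < 1" "0 < \<beta>" "\<beta> < 1" and w: "Im w \<noteq> 0"
  defines "P \<equiv> \<lambda>N \<beta>. poly (lommel q (Suc N) \<beta>) w * cnj (poly (lommel q N (\<beta> * q)) w)"
  shows "Im w * Im (P N \<beta>) \<le> 0 \<and> Im w * Im (cnj w * P N \<beta>) < 0"
  using assms(3,4)
proof (induction N arbitrary: \<beta>)
  case 0
  then show ?case using w by (simp add: P_def zero_less_mult_iff) linarith
next
  case (Suc N)
  note s = shift_unit[OF assms(1,2) Suc.prems] and c = lommel_step_pos[OF assms(1,2) Suc.prems]
  define c u v where "c = lommel_step q \<beta>"
    and "u = poly (lommel q (Suc N) (\<beta> * q)) w" and "v = poly (lommel q N (\<beta> * q\<^sup>2)) w"
  have "P N (\<beta> * q) = u * cnj v" by (simp add: P_def u_def v_def power2_eq_square mult.assoc)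
  with Suc.IH[OF s(1,2)] have IH: "Im w * Im (u * cnj v) \<le> 0" "Im w * Im (cnj w * (u * cnj v)) < 0"
    by auto
  then have "u \<noteq> 0" by auto
  have P: "P (Suc N) \<beta> = (u - of_real c * (w * v)) * cnj u"
    by (simp add: P_def u_def v_def c_def)
  have "Im (P (Suc N) \<beta>) = c * Im (cnj w * (u * cnj v))"
    unfolding P by (simp add: algebra_simps)
  then have 1: "Im w * Im (P (Suc N) \<beta>) = c * (Im w * Im (cnj w * (u * cnj v)))"
    by (simp only: mult.left_commute)
  have Im_eq: "Im (cnj w * P (Suc N) \<beta>)
      = - Im w * ((Re u)\<^sup>2 + (Im u)\<^sup>2) + c * ((Re w)\<^sup>2 + (Im w)\<^sup>2) * Im (u * cnj v)"
    unfolding P by (simp add: power2_eq_square algebra_simps)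
  have 2: "Im w * Im (cnj w * P (Suc N) \<beta>)
      = - ((Im w)\<^sup>2 * ((Re u)\<^sup>2 + (Im u)\<^sup>2)) + c * ((Re w)\<^sup>2 + (Im w)\<^sup>2) * (Im w * Im (u * cnj v))"
    unfolding Im_eq by (simp add: power2_eq_square algebra_simps)
  have "0 < (Im w)\<^sup>2 * ((Re u)\<^sup>2 + (Im u)\<^sup>2)"
    using w \<open>u \<noteq> 0\<close> by (simp add: complex_eq_iff sum_power2_gt_zero_iff)
  moreover have "c * ((Re w)\<^sup>2 + (Im w)\<^sup>2) * (Im w * Im (u * cnj v)) \<le> 0"
    using c unfolding c_def by (intro mult_nonneg_nonpos[OF _ IH(1)]) auto
  ultimately have "Im w * Im (cnj w * P (Suc N) \<beta>) < 0" unfolding 2 by linarith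
  moreover have "Im w * Im (P (Suc N) \<beta>) \<le> 0"
    unfolding 1 using c unfolding c_def by (intro mult_nonneg_nonpos[OF _ less_imp_le[OF IH(2)]]) auto
  ultimately show ?case by blast
qed

lemma lommel_nonpos_real:
  assumes "0 < q" "q < 1" "0 < \<beta>" "\<beta> < 1" "x \<le> 0"
  shows "\<exists>r\<ge>1. poly (lommel q N \<beta>) (of_real x) = of_real r"
  using assms(1-4)
proof (induction q N \<beta> rule: lommel.induct)
  case (3 q N \<beta>)
  note s = shift_unit[OF "3.prems"] and c = lommel_step_pos[OF "3.prems"]
  obtain r where r: "r \<ge> 1" "poly (lommel q (Suc N) (\<beta> * q)) (of_real x) = of_real r"
    using 3 s by blast
  obtain r' where r': "r' \<ge> 1" "poly (lommel q N (\<beta> * q\<^sup>2)) (of_real x) = of_real r'"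
    using 3 s by blast
  have "lommel_step q \<beta> * (x * r') \<le> 0"
    by (intro mult_nonneg_nonpos mult_nonpos_nonneg assms(5)) (use c r' in auto)
  then show ?case using r r'
    by (intro exI[of _ "r - lommel_step q \<beta> * (x * r')"]) auto
qed auto

lemma lommel_zeros_positive:
  assumes "0 < q" "q < 1" "0 < \<beta>" "\<beta> < 1" "poly (lommel q N \<beta>) w = 0"
  shows "\<exists>r>0. w = of_real r"
proof (cases "Im w = 0")
  case True
  then have "w = of_real (Re w)" by (simp add: complex_eq_iff)
  moreover from this have "Re w > 0"
    using lommel_nonpos_real[OF assms(1-4), of "Re w" N] assms(5) by (cases "Re w \<le> 0") auto
  ultimately show ?thesis by blast
next
  case False
  obtain M where "N = Suc M" using assms(5) by (cases N) auto
  then show ?thesis using lommel_Im[OF assms(1-4) False, of M] assms(5) by auto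
qed

lemma bessel_coeff_powr:
  assumes "0 < q"
  shows "bessel_coeff q (q powr (\<nu> + 1)) n
    = q powr (real n * (real n + \<nu>)) / (4 ^ n * qpoch q q n * qpoch (q powr (\<nu> + 1)) q n)"
proof -
  have "(q powr (\<nu> + 1)) ^ n = q powr (real n * (\<nu> + 1))"
    using assms by (simp add: powr_power mult.commute)
  then have "q ^ (n * (n - 1)) * (q powr (\<nu> + 1)) ^ n
      = q powr real (n * (n - 1)) * q powr (real n * (\<nu> + 1))"
    by (simp only: powr_realpow[OF assms])
  also have "\<dots> = q powr (real (n * (n - 1)) + real n * (\<nu> + 1))" by (simp add: powr_add)
  also have "real (n * (n - 1)) + real n * (\<nu> + 1) = real n * (real n + \<nu>)"
    by (cases n) (auto simp: algebra_simps)
  finally show ?thesis by (simp add: bessel_coeff_def)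
qed

lemma entire_bessel_coeff:
  assumes nu: "- 1 < \<nu>" and q: "0 < q" "q < 1"
  shows "entire_coeffs (bessel_coeff q (q powr (\<nu> + 1)))"
  unfolding entire_coeffs_def
proof safe
  note b = qpowr_bounds[OF nu q]
  show "0 \<le> bessel_coeff q (q powr (\<nu> + 1)) n" for n
    using bessel_coeff_pos[OF q b] less_imp_le by blast
  fix r :: real
  \<comment> \<open>at a square root of \<open>- r\<close> the sign in the Bessel series turns \<open>z ^ (2 * n)\<close> into \<open>r ^ n\<close>\<close>
  define z where "z = csqrt (of_real (- r))"
  have "z\<^sup>2 = - of_real r" by (simp add: z_def)
  then have zpow: "z ^ (2 * n + 1) = z * ((-1) ^ n * of_real r ^ n)" for n
    by (simp add: power_mult flip: power_mult_distrib)
  have "summable (\<lambda>n. (-1) ^ n * of_real (q powr (real n * (real n + \<nu>)))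
      / of_real (4 ^ n * qpoch q q n * qpoch (q powr (\<nu> + 1)) q n) * (z * ((-1) ^ n * of_real r ^ n)))"
    using normalized_bessel2_summable[OF nu q, of z] by (simp only: zpow)
  moreover have "(-1) ^ n * of_real (q powr (real n * (real n + \<nu>)))
      / of_real (4 ^ n * qpoch q q n * qpoch (q powr (\<nu> + 1)) q n) * (z * ((-1) ^ n * of_real r ^ n))
    = z * of_real (bessel_coeff q (q powr (\<nu> + 1)) n * r ^ n)" for n
  proof -
    have "((-1) ^ n * (-1) ^ n :: complex) = 1" by (simp flip: power_mult_distrib)
    moreover have "s * A / B * (z * (s * R)) = s * s * (z * (A / B * R))" for s A B R :: complex
      by (simp add: mult_ac)
    ultimately show ?thesis unfolding bessel_coeff_powr[OF q(1)] by simp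
  qed
  ultimately have sm: "summable (\<lambda>n. z * of_real (bessel_coeff q (q powr (\<nu> + 1)) n * r ^ n))"
    by (simp only:)
  show "summable (\<lambda>n. bessel_coeff q (q powr (\<nu> + 1)) n * r ^ n)"
  proof (cases "r = 0")
    case True
    show ?thesis by (rule summable_finite[of "{0}"]) (simp_all add: True)
  next
    case False
    then have "z \<noteq> 0" by (simp add: z_def)
    with sm have "summable (\<lambda>n. of_real (bessel_coeff q (q powr (\<nu> + 1)) n * r ^ n) :: complex)"
      by (rule summable_mult_D)
    then show ?thesis by (simp only: summable_of_real_iff)
  qed
qed

text \<open>All zeros of the Lommel polynomials are positive, so they are products of the required
  form.\<close>

lemma bessel_root_limit:
  assumes nu: "- 1 < \<nu>" and q: "0 < q" "q < 1"
  shows "\<exists>X. root_limit (bessel_coeff q (q powr (\<nu> + 1))) X"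
proof -
  let ?b = "q powr (\<nu> + 1)"
  note b = qpowr_bounds[OF nu q]
  note bounds = lommel_coeff_bounds[OF q b] and conv = lommel_coeff_tendsto[OF q b]
  have "\<exists>X. (\<forall>x\<in>set X. 0 < x) \<and> lommel q N ?b = rootprod X" for N
  proof (rule exists_rootprod[OF _ lommel_zeros_positive[OF q b]])
    have "lommel_coeff q N \<beta> 0 = 1" for \<beta>
      by (induction q N \<beta> "0::nat" rule: lommel_coeff.induct) auto
    then show "coeff (lommel q N ?b) 0 = 1" by (simp add: coeff_lommel)
  qed
  then obtain X where X: "\<And>N. \<forall>x\<in>set (X N). 0 < x" "\<And>N. lommel q N ?b = rootprod (X N)"
    by metis
  have "root_limit (bessel_coeff q ?b) X"
    unfolding root_limit_def X(2)[symmetric] coeff_lommel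
  proof (intro conjI allI)
    show "entire_coeffs (bessel_coeff q ?b)" by (rule entire_bessel_coeff[OF nu q])
    show "\<forall>x\<in>set (X N). 0 < x" for N by (rule X(1))
    show "norm (complex_of_real ((-1) ^ n * lommel_coeff q N ?b n)) \<le> bessel_coeff q ?b n" for N n
      using bounds[of N n] by (simp add: norm_mult norm_power)
    show "(\<lambda>N. complex_of_real ((-1) ^ n * lommel_coeff q N ?b n))
        \<longlonglongrightarrow> of_real ((-1) ^ n * bessel_coeff q ?b n)" for n
      by (intro tendsto_intros conv)
  qed
  then show ?thesis by blast
qed

section \<open>The least zero of a limit\<close>

lemma root_limit_at_0:
  assumes "root_limit e X"
  shows "e 0 = 1"
  using root_limitD(4)[OF assms, of 0] unfolding newton_rootprod
  by (simp add: LIMSEQ_const_iff)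

text \<open>The first half of the estimate also yields the existence of a positive zero: a zero-free
  half-line would make \<open>M * psum3 e\<close> bounded in \<open>M\<close>.\<close>

lemma least_zero:
  assumes lim: "root_limit e X" and pos: "0 < psum2 e" "0 < psum3 e"
  obtains \<gamma> :: real where "0 < \<gamma>" "alt_series e \<gamma> = 0" "\<And>s. 0 \<le> s \<Longrightarrow> s < \<gamma> \<Longrightarrow> 0 < alt_series e s"
    "1 \<le> \<gamma> ^ 3 * psum3 e" "\<gamma> * psum3 e \<le> psum2 e"
proof -
  define F :: "real \<Rightarrow> real" where "F = alt_series e"
  have cont: "isCont F s" for s unfolding F_def by (rule isCont_alt_series[OF root_limitD(1)[OF lim]])
  have F0: "F 0 = 1" by (simp add: F_def alt_series_0 root_limit_at_0[OF lim])
  define Z where "Z = {s. 0 \<le> s \<and> F s = 0}"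
  have "Z \<noteq> {}"
  proof
    assume "Z = {}"
    then have "(psum2 e / psum3 e + 1) * psum3 e \<le> psum2 e"
      using pos by (intro zero_free_imp_psum_le[OF lim]) (auto simp: Z_def F_def)
    moreover have "(psum2 e / psum3 e + 1) * psum3 e = psum2 e + psum3 e"
      using pos by (simp add: distrib_right)
    ultimately show False using pos by linarith
  qed
  moreover have bdd: "bdd_below Z" by (auto simp: Z_def intro!: bdd_belowI[of _ 0])
  moreover have "closed Z"
  proof -
    have "Z = {0..} \<inter> F -` {0}" by (auto simp: Z_def)
    moreover have "closed (F -` {0})"
      using continuous_closed_vimage[OF closed_singleton, of F] cont by auto
    ultimately show ?thesis by auto
  qed
  ultimately have \<gamma>: "Inf Z \<in> Z" by (intro closed_contains_Inf)
  define \<gamma> where "\<gamma> = Inf Z"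
  have z: "0 \<le> \<gamma>" "F \<gamma> = 0" using \<gamma> by (auto simp: Z_def \<gamma>_def)
  have nz: "F s \<noteq> 0" if "0 \<le> s" "s < \<gamma>" for s
    using cInf_lower[OF _ bdd, of s] that by (auto simp: Z_def \<gamma>_def)
  have "\<gamma> \<noteq> 0" using z F0 by auto
  with z have "0 < \<gamma>" by simp
  moreover have "0 < F s" if s: "0 \<le> s" "s < \<gamma>" for s
  proof (rule ccontr)
    assume "\<not> 0 < F s"
    then obtain t where "0 \<le> t" "t \<le> s" "F t = 0"
      using IVT2[of F s 0 0] F0 cont s by auto
    with nz[of t] s show False by auto
  qed
  moreover have "1 \<le> \<gamma> ^ 3 * psum3 e"
    using zero_imp_psum3_ge[OF lim z(1)] z(2) by (simp add: F_def)
  moreover have "\<gamma> * psum3 e \<le> psum2 e"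
  proof -
    have "\<gamma> \<le> psum2 e / psum3 e"
    proof (rule dense_le)
      fix M assume M: "M < \<gamma>"
      show "M \<le> psum2 e / psum3 e"
      proof (cases "0 \<le> M")
        case True
        then have "M * psum3 e \<le> psum2 e"
          using M nz by (intro zero_free_imp_psum_le[OF lim]) (auto simp: F_def)
        then show ?thesis using pos by (simp add: field_simps)
      next
        case False
        moreover have "0 < psum2 e / psum3 e" using pos by simp
        ultimately show ?thesis by linarith
      qed
    qed
    then show ?thesis using pos by (simp add: field_simps)
  qed
  ultimately show thesis using that[of \<gamma>] z(2) by (auto simp: F_def)
qed

section \<open>The radius of convexity\<close>

text \<open>Here \<open>f' z = d(z\<^sup>2)\<close> and \<open>(z f')' = (\<theta> d)(z\<^sup>2)\<close>, with \<open>d\<close> and \<open>\<theta> d\<close> the series of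
  \<open>theta_coeffs e\<close> and \<open>theta_coeffs (theta_coeffs e)\<close>. Inside the radius \<open>sqrt \<gamma>\<close> the real
  part of the quotient is bounded below by its value at the positive point of the circle; on a
  larger disc the quotient vanishes at \<open>sqrt \<gamma>\<close>, if it is defined there at all.\<close>

lemma radius_of_convexity_odd_series:
  assumes lim: "root_limit e X"
    and f: "\<And>z. f z = z * alt_series e (z\<^sup>2)"
    and \<gamma>: "0 < \<gamma>" "alt_series (theta_coeffs (theta_coeffs e)) \<gamma> = (0::real)"
      "\<And>s. 0 \<le> s \<Longrightarrow> s < \<gamma> \<Longrightarrow> (0::real) < alt_series (theta_coeffs (theta_coeffs e)) s"
  shows "radius_of_convexity f = ereal (sqrt \<gamma>)"
proof -
  define d where "d = theta_coeffs e"
  obtain Y where Y: "root_limit d Y" unfolding d_def using root_limit_theta[OF lim] by blast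
  note ent = root_limitD(1)[OF lim] root_limitD(1)[OF Y] entire_coeffs_theta[OF root_limitD(1)[OF Y]]
  have f_eq: "f = (\<lambda>z. z * alt_series e (z\<^sup>2))" using f by blast
  have f': "deriv f = (\<lambda>z. alt_series d (z\<^sup>2))"
    unfolding f_eq d_def by (rule ext DERIV_imp_deriv alt_series_odd_deriv ent)+
  have f'': "deriv f z + z * deriv (deriv f) z = alt_series (theta_coeffs d) (z\<^sup>2)" for z
  proof -
    obtain D where "(alt_series d has_field_derivative D) (at (z\<^sup>2))"
      using alt_series_differentiable[OF ent(2)] by blast
    then have "((\<lambda>z. alt_series d (z\<^sup>2)) has_field_derivative D * (2 * z)) (at z)"
      by (rule DERIV_chain2) (auto intro!: derivative_eq_intros)
    then have D: "(deriv f has_field_derivative deriv (deriv f) z) (at z)"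
      unfolding f' by (metis DERIV_imp_deriv)
    have "((\<lambda>z. z * deriv f z) has_field_derivative 1 * deriv f z + deriv (deriv f) z * z) (at z)"
      by (rule DERIV_mult[OF DERIV_ident D])
    moreover have "((\<lambda>z. z * deriv f z) has_field_derivative alt_series (theta_coeffs d) (z\<^sup>2)) (at z)"
      unfolding f' by (rule alt_series_odd_deriv[OF ent(2)])
    ultimately show ?thesis using DERIV_unique by (fastforce simp: mult.commute)
  qed
  have quot: "1 + z * deriv (deriv f) z / deriv f z = alt_series (theta_coeffs d) (z\<^sup>2) / deriv f z"
    if "deriv f z \<noteq> 0" for z
    using that unfolding f''[symmetric] by (simp add: field_simps)
  have pos: "0 < (alt_series d s :: real)" if s: "0 \<le> s" "s < \<gamma>" for s
  proof (cases "s = 0")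
    case True
    then show ?thesis by (simp add: alt_series_0 root_limit_at_0[OF Y])
  next
    case False
    \<comment> \<open>the odd function \<open>t \<mapsto> t d(t\<^sup>2)\<close> vanishes at \<open>0\<close> and has a positive derivative\<close>
    have "0 * alt_series d ((0::real)\<^sup>2) < sqrt s * alt_series d ((sqrt s)\<^sup>2)"
    proof (rule DERIV_pos_imp_increasing[where f = "\<lambda>t. t * alt_series d (t\<^sup>2)"])
      fix t assume t: "0 \<le> t" "t \<le> sqrt s"
      then have "t\<^sup>2 \<le> s" using s(1) by (metis power_mono real_sqrt_pow2)
      then have "0 < (alt_series (theta_coeffs d) (t\<^sup>2) :: real)"
        using \<gamma>(3)[of "t\<^sup>2"] s by (simp add: d_def)
      then show "\<exists>y. ((\<lambda>t. t * alt_series d (t\<^sup>2)) has_real_derivative y) (at t) \<and> 0 < y"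
        using alt_series_odd_deriv[OF ent(2), of t] by blast
    qed (use False s in auto)
    then show ?thesis using False s by (simp add: zero_less_mult_iff)
  qed
  define S where "S = {r. r > 0 \<and> (\<forall>z\<in>ball 0 r. deriv f z \<noteq> 0 \<and>
                     Re (1 + z * deriv (deriv f) z / deriv f z) > 0)}"
  have "sqrt \<gamma> \<in> S"
    unfolding S_def
  proof safe
    fix z :: complex assume "z \<in> ball 0 (sqrt \<gamma>)"
    then have "norm z < sqrt \<gamma>" by simp
    then have "(norm z)\<^sup>2 < (sqrt \<gamma>)\<^sup>2" by (intro power_strict_mono) auto
    then have z: "norm (z\<^sup>2) < \<gamma>" using \<gamma>(1) by (simp add: norm_power)
    have nz: "alt_series d s \<noteq> (0::real)" if "0 \<le> s" "s \<le> norm (z\<^sup>2)" for s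
      using pos[of s] that z by simp
    note ge = Re_theta_quotient_ge[OF Y nz]
    have ne: "deriv f z \<noteq> 0" unfolding f' using ge(1) by blast
    then show "deriv f z = 0 \<Longrightarrow> False" by blast
    have "0 < alt_series (theta_coeffs d) (norm (z\<^sup>2)) / (alt_series d (norm (z\<^sup>2)) :: real)"
      using pos[of "norm (z\<^sup>2)"] \<gamma>(3)[of "norm (z\<^sup>2)"] z by (simp add: d_def)
    also have "\<dots> \<le> Re (alt_series (theta_coeffs d) (z\<^sup>2) / alt_series d (z\<^sup>2))"
      using ge(2) by blast
    also have "\<dots> = Re (1 + z * deriv (deriv f) z / deriv f z)"
      by (simp only: quot[OF ne]) (simp only: f')
    finally show "0 < Re (1 + z * deriv (deriv f) z / deriv f z)" .
  qed (use \<gamma> in auto)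
  moreover have "r \<le> sqrt \<gamma>" if r: "r \<in> S" for r
  proof (rule ccontr)
    assume "\<not> r \<le> sqrt \<gamma>"
    then have "of_real (sqrt \<gamma>) \<in> ball (0::complex) r" using \<gamma>(1) by simp
    then have ne: "deriv f (of_real (sqrt \<gamma>)) \<noteq> 0"
      and "Re (1 + of_real (sqrt \<gamma>) * deriv (deriv f) (of_real (sqrt \<gamma>)) / deriv f (of_real (sqrt \<gamma>))) > 0"
      using r unfolding S_def by blast+
    moreover have "alt_series (theta_coeffs d) ((of_real (sqrt \<gamma>) :: complex)\<^sup>2) = 0"
      using \<gamma> alt_series_of_real[OF ent(3), of \<gamma>] by (simp add: d_def flip: of_real_power)
    ultimately show False unfolding quot[OF ne] by simp
  qed
  ultimately have "Sup (ereal ` S) = ereal (sqrt \<gamma>)"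
    by (intro antisym Sup_least Sup_upper) auto
  then show ?thesis unfolding radius_of_convexity_def S_def .
qed

lemma normalized_bessel2_alt_series:
  assumes nu: "- 1 < \<nu>" and q: "0 < q" "q < 1"
  shows "normalized_bessel2 \<nu> q z = z * alt_series (bessel_coeff q (q powr (\<nu> + 1))) (z\<^sup>2)"
proof -
  have "normalized_bessel2 \<nu> q z
      = (\<Sum>n. z * (of_real ((-1) ^ n * bessel_coeff q (q powr (\<nu> + 1)) n) * (z\<^sup>2) ^ n))"
    unfolding normalized_bessel2_series[OF assms] bessel_coeff_powr[OF q(1)]
    by (intro suminf_cong) (simp add: power_mult[symmetric])
  then show ?thesis
    unfolding alt_series_def
    by (simp only: suminf_mult[OF alt_series_summable[OF entire_bessel_coeff[OF assms]]])
qed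

section \<open>The equation for the radius\<close>

lemma powr_odd_series_deriv:
  fixes z :: complex
  assumes e: "entire_coeffs e" and z: "0 < Re z"
  shows "((\<lambda>z. z powr c * (z * alt_series e (z\<^sup>2))) has_field_derivative
    z powr (c - 1) * (c * (z * alt_series e (z\<^sup>2)) + z * alt_series (theta_coeffs e) (z\<^sup>2))) (at z)"
proof -
  have nz: "z \<notin> \<real>\<^sub>\<le>\<^sub>0" using z by (auto simp: complex_nonpos_Reals_iff)
  have "z powr c = z powr (c - 1) * z" using nz by (auto simp: powr_diff)
  then show ?thesis
    using DERIV_mult[OF has_field_derivative_powr[OF nz, of c] alt_series_odd_deriv[OF e, of z]]
    by (simp add: algebra_simps)
qed

text \<open>The principal powers in \<open>J\<close> have their branch cut on the negative axis, so identities between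
  functions, as needed for iterated derivatives, are used on the right half-plane only.\<close>

lemma deriv_cong_halfplane:
  fixes f g :: "complex \<Rightarrow> complex"
  assumes "\<And>z. 0 < Re z \<Longrightarrow> f z = g z" "0 < Re z" "(g has_field_derivative D) (at z)"
  shows "deriv f z = D"
proof -
  have "open {z. 0 < Re z}" by (rule open_halfspace_Re_gt)
  then have "(f has_field_derivative D) (at z)"
    using assms by (intro has_field_derivative_transform_within_open[OF assms(3)]) auto
  then show ?thesis by (rule DERIV_imp_deriv)
qed

text \<open>With \<open>\<theta> = z d/dz\<close> the left-hand side of the equation is \<open>(\<theta> + 1 - \<nu>)\<^sup>2 J\<close>, and \<open>J\<close> is a
  multiple of \<open>z powr (\<nu> - 1) g\<close>. Since \<open>\<theta> + 1 - \<nu>\<close> acts on \<open>z powr (\<nu> - 1) g\<close> as \<open>\<theta>\<close> does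
  on \<open>g\<close>, this is a multiple of \<open>\<theta>\<^sup>2 g\<close>.\<close>

lemma bessel_equation:
  assumes nu: "- 1 < \<nu>" and q: "0 < q" "q < 1" and r: "0 < r"
  shows "of_real ((1 - \<nu>)\<^sup>2) * jackson_bessel2 \<nu> q (of_real r)
       + of_real ((3 - 2 * \<nu>) * r) * deriv (jackson_bessel2 \<nu> q) (of_real r)
       + of_real (r\<^sup>2) * deriv (deriv (jackson_bessel2 \<nu> q)) (of_real r) = 0
    \<longleftrightarrow> alt_series (theta_coeffs (theta_coeffs (bessel_coeff q (q powr (\<nu> + 1))))) (r\<^sup>2) = (0::real)"
proof -
  define e where "e = bessel_coeff q (q powr (\<nu> + 1))"
  note ent = entire_bessel_coeff[OF nu q, folded e_def]
  note ent' = entire_coeffs_theta[OF ent]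
  define K where "K = (1 :: complex) / of_real (2 powr \<nu> * bessel_c \<nu> q)"
  define n :: complex where "n = of_real \<nu>"
  have "bessel_c \<nu> q \<noteq> 0"
    using qpoch_inf_nonzero(2)[OF q q] qpoch_inf_nonzero(2)[OF qpowr_bounds[OF nu q] q]
    by (simp add: bessel_c_def)
  then have K: "K \<noteq> 0" "of_real (2 powr \<nu> * bessel_c \<nu> q) * K = 1" by (simp_all add: K_def)
  define y y1 y2 where "y z = z * alt_series e (z\<^sup>2)"
    and "y1 z = z * alt_series (theta_coeffs e) (z\<^sup>2)"
    and "y2 z = z * alt_series (theta_coeffs (theta_coeffs e)) (z\<^sup>2)" for z :: complex
  have J: "jackson_bessel2 \<nu> q z = K * (z powr (n - 1) * y z)" if "0 < Re z" for z
  proof -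
    have "z \<noteq> 0" using that by auto
    then have p: "z powr (n - 1) * z powr (1 - n) = 1"
      by (simp flip: powr_add)
    have g: "of_real (2 powr \<nu> * bessel_c \<nu> q) * z powr (1 - n) * jackson_bessel2 \<nu> q z = y z"
      using normalized_bessel2_alt_series[OF nu q, of z]
      by (simp only: normalized_bessel2_def y_def e_def n_def of_real_diff of_real_1)
    have "K * (z powr (n - 1) * y z) = (of_real (2 powr \<nu> * bessel_c \<nu> q) * K)
        * (z powr (n - 1) * z powr (1 - n)) * jackson_bessel2 \<nu> q z"
      unfolding g[symmetric] by (simp only: mult_ac)
    then show ?thesis unfolding K p by simp
  qed
  have D: "((\<lambda>z. z powr c * y z) has_field_derivative z powr (c - 1) * (c * y z + y1 z)) (at z)"
    "((\<lambda>z. z powr c * y1 z) has_field_derivative z powr (c - 1) * (c * y1 z + y2 z)) (at z)"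
    if "0 < Re z" for z c
    unfolding y_def y1_def y2_def using powr_odd_series_deriv[OF ent that] powr_odd_series_deriv[OF ent' that]
    by blast+
  have J1: "deriv (jackson_bessel2 \<nu> q) z = K * (z powr (n - 2) * ((n - 1) * y z + y1 z))"
    if "0 < Re z" for z
    using deriv_cong_halfplane[OF J that DERIV_cmult[OF D(1)[OF that]]] by simp
  have J2: "deriv (deriv (jackson_bessel2 \<nu> q)) z = K * (z powr (n - 3) *
      ((n - 2) * ((n - 1) * y z + y1 z) + ((n - 1) * y1 z + y2 z)))" if "0 < Re z" for z
  proof (rule deriv_cong_halfplane[OF J1 that])
    have "((\<lambda>z. (n - 1) * (z powr (n - 2) * y z) + z powr (n - 2) * y1 z) has_field_derivative
        (n - 1) * (z powr (n - 2 - 1) * ((n - 2) * y z + y1 z))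
        + z powr (n - 2 - 1) * ((n - 2) * y1 z + y2 z)) (at z)"
      by (intro DERIV_add DERIV_cmult D that)
    then show "((\<lambda>z. K * (z powr (n - 2) * ((n - 1) * y z + y1 z))) has_field_derivative
        K * (z powr (n - 3) * ((n - 2) * ((n - 1) * y z + y1 z) + ((n - 1) * y1 z + y2 z)))) (at z)"
      by (intro DERIV_cmult) (simp add: algebra_simps)
  qed
  define z :: complex where "z = of_real r"
  have z: "0 < Re z" "z \<noteq> 0" using r by (auto simp: z_def)
  have pw: "z powr (n - 1) = z powr (n - 3) * z\<^sup>2" "z powr (n - 2) = z powr (n - 3) * z"
  proof -
    have "z powr (n - 3 + 1) = z powr (n - 3) * z"
      unfolding powr_add using z by simp
    moreover have "z powr (n - 3 + 1 + 1) = z powr (n - 3) * z\<^sup>2"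
      unfolding powr_add using z by (simp add: power2_eq_square)
    moreover have "n - 2 = n - 3 + 1" "n - 1 = n - 3 + 1 + 1" by simp_all
    ultimately show "z powr (n - 1) = z powr (n - 3) * z\<^sup>2" "z powr (n - 2) = z powr (n - 3) * z"
      by (simp_all only:)
  qed
  have "of_real ((1 - \<nu>)\<^sup>2) * jackson_bessel2 \<nu> q z
       + of_real ((3 - 2 * \<nu>) * r) * deriv (jackson_bessel2 \<nu> q) z
       + of_real (r\<^sup>2) * deriv (deriv (jackson_bessel2 \<nu> q)) z
     = K * z powr (n - 3) * z\<^sup>2 * y2 z"
  proof -
    have "of_real ((1 - \<nu>)\<^sup>2) = (1 - n)\<^sup>2" "of_real ((3 - 2 * \<nu>) * r) = (3 - 2 * n) * z"
      "of_real (r\<^sup>2) = z\<^sup>2"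
      by (simp_all add: n_def z_def)
    moreover have "(1 - n)\<^sup>2 * (K * (p * z\<^sup>2 * c)) + (3 - 2 * n) * z * (K * (p * z * ((n - 1) * c + c1)))
        + z\<^sup>2 * (K * (p * ((n - 2) * ((n - 1) * c + c1) + ((n - 1) * c1 + c2)))) = K * p * z\<^sup>2 * c2"
      for p c c1 c2 by algebra
    ultimately show ?thesis
      unfolding J[OF z(1)] J1[OF z(1)] J2[OF z(1)] pw by (simp only:)
  qed
  moreover have "y2 z = 0 \<longleftrightarrow> alt_series (theta_coeffs (theta_coeffs e)) (r\<^sup>2) = (0::real)"
    using z alt_series_of_real[OF entire_coeffs_theta[OF ent'], of "r\<^sup>2", where 'a = complex]
    by (simp add: y2_def z_def)
  ultimately show ?thesis using K z unfolding z_def[symmetric] e_def[symmetric] by simp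
qed

section \<open>The explicit bounds\<close>

text \<open>Up to powers of \<open>e 1\<close>, the power sums depend only on \<open>\<alpha> = e 2 / (e 1)\<^sup>2\<close> and
  \<open>\<kappa> = e 1 * e 3 / (e 2)\<^sup>2\<close>. The gaps between consecutive Euler-Rayleigh bounds are what makes
  the inequalities for the least zero strict, although the estimates by limits of polynomials
  are not.\<close>

lemma psum_gaps:
  fixes e :: "nat \<Rightarrow> real"
  assumes e1: "0 < e 1" and e2: "e 2 = \<alpha> * (e 1)\<^sup>2" and e3: "e 3 = \<kappa> * \<alpha>\<^sup>2 * e 1 ^ 3"
    and \<alpha>: "0 < \<alpha>" "\<alpha> \<le> 25 / 162" and \<kappa>: "0 < \<kappa>" "\<kappa> \<le> 294 / 625"
  shows "0 < psum2 e" "0 < psum3 e" "0 < psum3 e - e 3" "psum3 e < e 1 ^ 3"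
    "(psum2 e)\<^sup>2 < e 1 * psum3 e" "(psum3 e)\<^sup>2 < psum2 e ^ 3"
proof -
  have p2: "psum2 e = (e 1)\<^sup>2 * (1 - 2 * \<alpha>)"
    by (simp add: psum2_def e2 algebra_simps)
  have p3: "psum3 e = e 1 ^ 3 * (1 - 3 * \<alpha> + 3 * \<kappa> * \<alpha>\<^sup>2)"
    by (simp add: psum3_def e2 e3 power2_eq_square power3_eq_cube algebra_simps)
  have p3': "psum3 e - e 3 = e 1 ^ 3 * (1 - 3 * \<alpha> + 2 * \<kappa> * \<alpha>\<^sup>2)"
    by (simp add: p3 e3 algebra_simps)
  have k: "0 < \<kappa> * \<alpha>\<^sup>2" using \<alpha> \<kappa> by simp
  have \<kappa>\<alpha>: "0 < \<kappa> * \<alpha>" "\<kappa> * \<alpha> \<le> 294 / 625 * (25 / 162)"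
    using \<alpha> \<kappa> mult_mono[OF \<kappa>(2) \<alpha>(2)] by auto
  show "0 < psum2 e" unfolding p2 using e1 \<alpha> by simp
  show "0 < psum3 e" unfolding p3 using e1 \<alpha> k by (intro mult_pos_pos) auto
  show "0 < psum3 e - e 3" unfolding p3' using e1 \<alpha> k by (intro mult_pos_pos) auto
  have "\<alpha> * (\<kappa> * \<alpha>) < \<alpha> * 1" using \<alpha> \<kappa>\<alpha> by (intro mult_strict_left_mono) auto
  then have "1 - 3 * \<alpha> + 3 * \<kappa> * \<alpha>\<^sup>2 < 1" by (simp add: power2_eq_square algebra_simps)
  then show "psum3 e < e 1 ^ 3" unfolding p3 using e1 by simp
  have "e 1 * psum3 e - (psum2 e)\<^sup>2 = e 1 ^ 4 * (\<alpha> * (1 - 4 * \<alpha>) + 3 * \<kappa> * \<alpha>\<^sup>2)"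
    unfolding p2 p3 by (simp add: power2_eq_square power3_eq_cube eval_nat_numeral algebra_simps)
  moreover have "0 < e 1 ^ 4 * (\<alpha> * (1 - 4 * \<alpha>) + 3 * \<kappa> * \<alpha>\<^sup>2)"
    using e1 \<alpha> \<kappa> by (intro mult_pos_pos add_pos_pos zero_less_power) auto
  ultimately show "(psum2 e)\<^sup>2 < e 1 * psum3 e" by linarith
  have "psum2 e ^ 3 - (psum3 e)\<^sup>2
      = e 1 ^ 6 * (\<alpha>\<^sup>2 * (3 - 8 * \<alpha> - 6 * \<kappa> + 18 * (\<kappa> * \<alpha>) - 9 * (\<kappa> * \<alpha>)\<^sup>2))"
    unfolding p2 p3 by (simp add: power2_eq_square power3_eq_cube eval_nat_numeral algebra_simps)
  \<comment> \<open>the products \<open>\<kappa> * \<alpha>\<close> are replaced by their linear lower bound at the corner of the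
    rectangle of admissible \<open>(\<alpha>, \<kappa>)\<close>\<close>
  moreover have "0 < 3 - 8 * \<alpha> - 6 * \<kappa> + 18 * (\<kappa> * \<alpha>) - 9 * (\<kappa> * \<alpha>)\<^sup>2"
  proof -
    have "(294 / 625 - \<kappa>) * (25 / 162 - \<alpha>) \<ge> 0" using \<alpha> \<kappa> by (intro mult_nonneg_nonneg) auto
    moreover have "(294 / 625 - \<kappa>) * (25 / 162 - \<alpha>)
        = 294 / 625 * (25 / 162) - 25 / 162 * \<kappa> - 294 / 625 * \<alpha> + \<kappa> * \<alpha>"
      by (simp add: field_simps)
    ultimately have "\<kappa> * \<alpha> \<ge> 25 / 162 * \<kappa> + 294 / 625 * \<alpha> - 294 / 625 * (25 / 162)"
      by linarith
    moreover have "(\<kappa> * \<alpha>)\<^sup>2 \<le> (294 / 625 * (25 / 162))\<^sup>2"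
      using \<kappa>\<alpha> by (intro power_mono) auto
    ultimately show ?thesis using \<alpha> \<kappa> \<kappa>\<alpha> by (simp add: power2_eq_square field_simps)
  qed
  then have "0 < e 1 ^ 6 * (\<alpha>\<^sup>2 * (3 - 8 * \<alpha> - 6 * \<kappa> + 18 * (\<kappa> * \<alpha>) - 9 * (\<kappa> * \<alpha>)\<^sup>2))"
    using e1 \<alpha> by (intro mult_pos_pos zero_less_power)
  ultimately show "(psum3 e)\<^sup>2 < psum2 e ^ 3" by linarith
qed

text \<open>With \<open>p k\<close> the \<open>k\<close>-th power sum: the bounds of orders one and two follow from those of order
  three, \<open>p3\<close> being strictly smaller than the powers of \<open>p1\<close> and \<open>p2\<close> of the same
  weight and \<open>p2 / p3\<close> strictly smaller than \<open>p1 / p2\<close>.\<close>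

lemma least_zero_bounds:
  fixes \<gamma> p1 p2 p3 :: real
  assumes \<gamma>: "0 < \<gamma>" "1 \<le> \<gamma> ^ 3 * p3" "\<gamma> * p3 \<le> p2"
    and p: "0 < p1" "0 < p2" "0 < p3" "p3 < p1 ^ 3" "p2\<^sup>2 < p1 * p3" "p3\<^sup>2 < p2 ^ 3"
  shows "1 < \<gamma> * p1" "1 < \<gamma>\<^sup>2 * p2" "\<gamma> * p2 < p1"
proof -
  show "1 < \<gamma> * p1"
  proof (rule ccontr)
    assume "\<not> ?thesis"
    then have "(\<gamma> * p1) ^ 3 \<le> 1" using \<gamma> p by (intro power_le_one) auto
    moreover have "\<gamma> ^ 3 * p3 < \<gamma> ^ 3 * p1 ^ 3" using \<gamma> p by simp
    ultimately show False using \<gamma>(2) by (simp add: power_mult_distrib)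
  qed
  show "1 < \<gamma>\<^sup>2 * p2"
  proof (rule ccontr)
    assume "\<not> ?thesis"
    then have "(\<gamma>\<^sup>2 * p2) ^ 3 \<le> 1" using \<gamma> p by (intro power_le_one) auto
    moreover have "1 \<le> (\<gamma> ^ 3 * p3)\<^sup>2" using \<gamma>(2) by (rule one_le_power)
    moreover have "\<gamma> ^ 6 * p3\<^sup>2 < \<gamma> ^ 6 * p2 ^ 3" using \<gamma> p by simp
    ultimately show False by (simp add: power_mult_distrib flip: power_mult)
  qed
  have "(\<gamma> * p2) * p3 = (\<gamma> * p3) * p2" by simp
  also have "\<dots> \<le> p2 * p2" using \<gamma> p by (intro mult_right_mono) auto
  also have "\<dots> < p1 * p3" using p by (simp add: power2_eq_square)
  finally show "\<gamma> * p2 < p1" using p by simp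
qed

lemma bessel_coeff_123:
  assumes q: "0 < q" "q < (1::real)" and b: "0 < b" "b < 1"
  shows "bessel_coeff q b 1 = b / (4 * (1 - q) * (1 - b))"
    "bessel_coeff q b 2 = q\<^sup>2 * b\<^sup>2 / (16 * ((1 - q) * (1 - q\<^sup>2)) * ((1 - b) * (1 - b * q)))"
    "bessel_coeff q b 3 = q ^ 6 * b ^ 3
      / (64 * ((1 - q) * (1 - q\<^sup>2) * (1 - q ^ 3)) * ((1 - b) * (1 - b * q) * (1 - b * q\<^sup>2)))"
  by (simp_all add: bessel_coeff_def eval_nat_numeral qpoch_Suc mult_ac)

text \<open>The factors \<open>9\<close>, \<open>25\<close> and \<open>49\<close> are the weights \<open>(2 n + 1)\<^sup>2\<close> of the convexity series.\<close>

lemma bessel_ratios: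
  assumes q: "0 < q" "q < (1::real)" and b: "0 < b" "b < 1"
  defines "e \<equiv> theta_coeffs (theta_coeffs (bessel_coeff q b))"
  obtains \<alpha> \<kappa> where "0 < \<alpha>" "\<alpha> \<le> 25 / 162" "0 < \<kappa>" "\<kappa> \<le> 294 / 625"
    "e 1 = 9 * b / (4 * (1 - q) * (1 - b))" "e 2 = \<alpha> * (e 1)\<^sup>2" "e 3 = \<kappa> * \<alpha>\<^sup>2 * e 1 ^ 3"
proof
  have bq: "0 < b * q" "b * q < 1" "0 < b * q\<^sup>2" "b * q\<^sup>2 < 1" "b * q \<le> b" "b * q\<^sup>2 \<le> b * q"
    using shift_unit[OF q b] q b by (auto simp: power2_eq_square mult_left_le)
  define \<alpha> where "\<alpha> = 25 / 81 * ((q\<^sup>2 / (1 + q)) * ((1 - b) / (1 - b * q)))"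
  define \<kappa> where "\<kappa> = 441 / 625 * ((q\<^sup>2 * (1 + q) / (1 + q + q\<^sup>2)) * ((1 - b * q) / (1 - b * q\<^sup>2)))"
  have e: "e 1 = 9 * bessel_coeff q b 1" "e 2 = 25 * bessel_coeff q b 2" "e 3 = 49 * bessel_coeff q b 3"
    by (simp_all add: e_def theta_coeffs_def)
  show e1: "e 1 = 9 * b / (4 * (1 - q) * (1 - b))" unfolding e(1) bessel_coeff_123(1)[OF q b] by simp
  have f: "1 - q\<^sup>2 = (1 - q) * (1 + q)" "1 - q ^ 3 = (1 - q) * (1 + q + q\<^sup>2)"
    by (simp_all add: power2_eq_square power3_eq_cube algebra_simps)
  have p: "0 < 1 - q" "0 < 1 + q" "0 < 1 + q + q\<^sup>2" "0 < 1 - b" "0 < 1 - b * q" "0 < 1 - b * q\<^sup>2"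
    using q b bq by (auto intro!: add_pos_pos)
  show "0 < \<alpha>" "0 < \<kappa>" unfolding \<alpha>_def \<kappa>_def using p q by auto
  have q2: "q\<^sup>2 \<le> q" "q ^ 3 \<le> q\<^sup>2"
    using q by (auto simp: power2_eq_square power3_eq_cube mult_left_le)
  have "(q\<^sup>2 / (1 + q)) * ((1 - b) / (1 - b * q)) \<le> 1 / 2 * 1"
  proof (rule mult_mono)
    show "q\<^sup>2 / (1 + q) \<le> 1 / 2" using p q2 q by (simp add: divide_le_eq)
    show "(1 - b) / (1 - b * q) \<le> 1" using p bq by simp
  qed (use p bq q in auto)
  from mult_left_mono[OF this, of "25 / 81"] show "\<alpha> \<le> 25 / 162" unfolding \<alpha>_def by linarith
  have "(q\<^sup>2 * (1 + q) / (1 + q + q\<^sup>2)) * ((1 - b * q) / (1 - b * q\<^sup>2)) \<le> 2 / 3 * 1"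
  proof (rule mult_mono)
    have "q\<^sup>2 * (1 + q) * 3 = 3 * q\<^sup>2 + 3 * q ^ 3"
      by (simp add: power2_eq_square power3_eq_cube algebra_simps)
    also have "\<dots> \<le> 2 + 2 * q + 2 * q\<^sup>2" using q2 q by linarith
    finally show "q\<^sup>2 * (1 + q) / (1 + q + q\<^sup>2) \<le> 2 / 3"
      using p by (simp add: divide_le_eq)
    show "(1 - b * q) / (1 - b * q\<^sup>2) \<le> 1" using p bq by simp
  qed (use p bq q in auto)
  from mult_left_mono[OF this, of "441 / 625"] show "\<kappa> \<le> 294 / 625" unfolding \<kappa>_def by linarith
  define s t u where "s = 1 - q" and "t = 1 + q" and "u = 1 + q + q\<^sup>2"
  define B0 B1 B2 where "B0 = 1 - b" and "B1 = 1 - b * q" and "B2 = 1 - b * q\<^sup>2"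
  have nz: "s \<noteq> 0" "t \<noteq> 0" "u \<noteq> 0" "B0 \<noteq> 0" "B1 \<noteq> 0" "B2 \<noteq> 0"
    using p unfolding s_def t_def u_def B0_def B1_def B2_def by linarith+
  show "e 2 = \<alpha> * (e 1)\<^sup>2"
    unfolding e bessel_coeff_123[OF q b] f \<alpha>_def
    unfolding u_def[symmetric]
    unfolding s_def[symmetric] t_def[symmetric]
      B0_def[symmetric] B1_def[symmetric] B2_def[symmetric]
    using nz by (simp add: field_simps) algebra
  show "e 3 = \<kappa> * \<alpha>\<^sup>2 * e 1 ^ 3"
    unfolding e bessel_coeff_123[OF q b] f \<alpha>_def \<kappa>_def
    unfolding u_def[symmetric]
    unfolding s_def[symmetric] t_def[symmetric]
      B0_def[symmetric] B1_def[symmetric] B2_def[symmetric]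
    using nz by (simp add: field_simps) algebra
qed

lemma powr_shift:
  fixes q :: real
  assumes "0 < q" and b: "b = q powr (\<nu> + 1)"
  shows "q powr (\<nu> + 2) = b * q" "q powr (\<nu> + 3) = b * q\<^sup>2" "q powr (\<nu> + 4) = b * q ^ 3"
    "q powr (\<nu> + 5) = b * q ^ 4" "q powr (\<nu> + 6) = b * q ^ 5" "q powr (\<nu> + 7) = b * q ^ 6"
    "q powr (2 * (\<nu> + 1)) = b\<^sup>2" "q powr (2 * \<nu> + 5) = b\<^sup>2 * q ^ 3"
    "q powr (2 * \<nu> + 6) = b\<^sup>2 * q ^ 4" "q powr (2 * \<nu> + 7) = b\<^sup>2 * q ^ 5"
    "q powr (2 * \<nu> + 8) = b\<^sup>2 * q ^ 6"
proof -
  have 1: "q powr (\<nu> + 1 + real k) = b * q ^ k" for k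
    using assms by (simp add: powr_add powr_realpow)
  have 2: "q powr (2 * (\<nu> + 1) + real k) = b\<^sup>2 * q ^ k" for k
  proof -
    have "q powr (2 * (\<nu> + 1)) = q powr (\<nu> + 1 + (\<nu> + 1))" by simp
    also have "\<dots> = b\<^sup>2" unfolding b powr_add[of q "\<nu> + 1" "\<nu> + 1"] power2_eq_square ..
    finally show ?thesis using assms by (simp add: powr_add powr_realpow)
  qed
  show "q powr (\<nu> + 2) = b * q" "q powr (\<nu> + 3) = b * q\<^sup>2" "q powr (\<nu> + 4) = b * q ^ 3"
    "q powr (\<nu> + 5) = b * q ^ 4" "q powr (\<nu> + 6) = b * q ^ 5" "q powr (\<nu> + 7) = b * q ^ 6"
    using 1[of 1] 1[of 2] 1[of 3] 1[of 4] 1[of 5] 1[of 6] by (simp_all add: add.assoc)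
  show "q powr (2 * (\<nu> + 1)) = b\<^sup>2" "q powr (2 * \<nu> + 5) = b\<^sup>2 * q ^ 3"
    "q powr (2 * \<nu> + 6) = b\<^sup>2 * q ^ 4" "q powr (2 * \<nu> + 7) = b\<^sup>2 * q ^ 5"
    "q powr (2 * \<nu> + 8) = b\<^sup>2 * q ^ 6"
    using 2[of 0] 2[of 3] 2[of 4] 2[of 5] 2[of 6] by (simp_all add: distrib_left add.assoc)
qed

text \<open>The last expression of the theorem contains \<open>psum3 e - e 3\<close> in place of \<open>psum3 e\<close>: the
  bound is slightly weaker than the Euler-Rayleigh bound \<open>psum2 e / psum3 e\<close>. The other three are
  the Euler-Rayleigh bounds of the lowest orders.\<close>

lemma bessel_bounds_eq:
  assumes q: "0 < q" "q < (1::real)" and b: "0 < b" "b < 1" "b = q powr (\<nu> + 1)"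
  defines "e \<equiv> theta_coeffs (theta_coeffs (bessel_coeff q b))"
  assumes pos: "0 < e 1" "0 < psum2 e" "0 < psum3 e - e 3"
  shows "4 * (1 - b) * (1 - q) / (9 * b) = 1 / e 1"
    "36 * (q\<^sup>2 - 1) * (1 - b) * (1 - q powr (\<nu> + 2)) / (b * S_poly \<nu> q) = e 1 / psum2 e"
    "(1 + q) * (1 - q)\<^sup>2 * (1 - b)\<^sup>2 * (q powr (\<nu> + 2) - 1) / (q powr (2 * (\<nu> + 1)) * S_poly \<nu> q)
      = 1 / (16 * psum2 e)"
    "4 * (1 - b) * (1 - q powr (\<nu> + 3)) * T_poly q * S_poly \<nu> q
      / (b * (1 + q) * (P_poly \<nu> q + R_poly \<nu> q)) = psum2 e / (psum3 e - e 3)"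
proof -
  have e: "e 1 = 9 * bessel_coeff q b 1" "e 2 = 25 * bessel_coeff q b 2" "e 3 = 49 * bessel_coeff q b 3"
    by (simp_all add: e_def theta_coeffs_def)
  have f: "1 - q\<^sup>2 = (1 - q) * (1 + q)" "1 - q ^ 3 = (1 - q) * (1 + q + q\<^sup>2)"
    "q\<^sup>2 - 1 = - ((1 - q) * (1 + q))" "b * q - 1 = - (1 - b * q)"
    by (simp_all add: power2_eq_square power3_eq_cube algebra_simps)
  have T: "T_poly q = - ((1 - q) * (1 + q) * (1 + q + q\<^sup>2))"
    by (simp add: T_poly_def power2_eq_square power3_eq_cube algebra_simps)
  define S where "S = - S_poly \<nu> q"
  define W where "W = P_poly \<nu> q + R_poly \<nu> q"
  note pw = powr_shift[OF q(1) b(3)]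
  define s t u where "s = 1 - q" and "t = 1 + q" and "u = 1 + q + q\<^sup>2"
  define B0 B1 B2 where "B0 = 1 - b" and "B1 = 1 - b * q" and "B2 = 1 - b * q\<^sup>2"
  have p: "0 < s" "0 < t" "0 < u" "0 < B0" "0 < B1" "0 < B2"
    using q b shift_unit[OF q b(1,2)] unfolding s_def t_def u_def B0_def B1_def B2_def
    by (auto intro!: add_pos_pos)
  then have nz: "s \<noteq> 0" "t \<noteq> 0" "u \<noteq> 0" "B0 \<noteq> 0" "B1 \<noteq> 0" "B2 \<noteq> 0" "b \<noteq> 0"
    using b by auto
  \<comment> \<open>written in the factors of the denominators, \<open>S\<close> and \<open>W\<close> are, up to powers of \<open>b\<close>, the
    numerators of \<open>psum2 e\<close> and \<open>psum3 e - e 3\<close>\<close>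
  have S_eq: "S = 81 * t * B1 - 50 * q\<^sup>2 * B0"
    unfolding S_def S_poly_def pw t_def B0_def B1_def
    by (simp add: power2_eq_square algebra_simps)
  have W_eq: "W = 729 * t * u * B1 * B2 - 675 * q\<^sup>2 * u * B0 * B2 + 98 * q ^ 6 * B0\<^sup>2"
    unfolding W_def P_poly_def R_poly_def pw t_def u_def B0_def B1_def B2_def
    by (simp add: eval_nat_numeral algebra_simps)
  note abbr = s_def[symmetric] t_def[symmetric]
      B0_def[symmetric] B1_def[symmetric] B2_def[symmetric]
  have e1: "e 1 = 9 * b / (4 * s * B0)"
    unfolding e bessel_coeff_123[OF q b(1,2)] f u_def[symmetric]
    unfolding abbr by simp
  have e2: "e 2 = 25 * q\<^sup>2 * b\<^sup>2 / (16 * s\<^sup>2 * t * B0 * B1)"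
    unfolding e bessel_coeff_123[OF q b(1,2)] f u_def[symmetric]
    unfolding abbr by (simp add: power2_eq_square mult_ac)
  have e3: "e 3 = 49 * q ^ 6 * b ^ 3 / (64 * s ^ 3 * t * u * B0 * B1 * B2)"
    unfolding e bessel_coeff_123[OF q b(1,2)] f u_def[symmetric]
    unfolding abbr by (simp add: power3_eq_cube mult_ac)
  have p2: "psum2 e = b\<^sup>2 * S / (16 * s\<^sup>2 * B0\<^sup>2 * t * B1)"
    unfolding psum2_def e1 e2 S_eq using nz by (simp add: field_simps) algebra
  have p3: "psum3 e - e 3 = b ^ 3 * W / (64 * s ^ 3 * B0 ^ 3 * t * u * B1 * B2)"
    unfolding psum3_def e1 e2 e3 W_eq using nz by (simp add: field_simps) algebra
  have S0: "S \<noteq> 0" "W \<noteq> 0" using pos p2 p3 by auto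
  have SP: "S_poly \<nu> q = - S" by (simp add: S_def)
  show "4 * (1 - b) * (1 - q) / (9 * b) = 1 / e 1"
    unfolding e1 u_def[symmetric]
    unfolding abbr using nz by (simp add: field_simps)
  show "36 * (q\<^sup>2 - 1) * (1 - b) * (1 - q powr (\<nu> + 2)) / (b * S_poly \<nu> q) = e 1 / psum2 e"
    unfolding pw f SP u_def[symmetric]
    unfolding abbr e1 p2 using nz S0 by (simp add: field_simps) algebra
  show "(1 + q) * (1 - q)\<^sup>2 * (1 - b)\<^sup>2 * (q powr (\<nu> + 2) - 1) / (q powr (2 * (\<nu> + 1)) * S_poly \<nu> q)
      = 1 / (16 * psum2 e)"
    unfolding pw f SP u_def[symmetric]
    unfolding abbr p2 using nz S0 by (simp add: field_simps)
  show "4 * (1 - b) * (1 - q powr (\<nu> + 3)) * T_poly q * S_poly \<nu> q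
      / (b * (1 + q) * (P_poly \<nu> q + R_poly \<nu> q)) = psum2 e / (psum3 e - e 3)"
    unfolding W_def[symmetric] pw f T SP u_def[symmetric]
    unfolding abbr p2 p3 using nz S0 by (simp add: field_simps) algebra
qed

theorem theorem1:
  fixes \<nu> q :: real
  assumes "\<nu> > - 1" and "0 < q" and "q < 1"
  shows "\<exists>rc :: real.
     radius_of_convexity (normalized_bessel2 \<nu> q) = ereal rc \<and>
     smallest_positive_root (\<lambda>r.
         of_real ((1 - \<nu>)\<^sup>2) * jackson_bessel2 \<nu> q (of_real r)
       + of_real ((3 - 2 * \<nu>) * r) * deriv (jackson_bessel2 \<nu> q) (of_real r)
       + of_real (r\<^sup>2) * deriv (deriv (jackson_bessel2 \<nu> q)) (of_real r)) rc \<and>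
     sqrt (4 * (1 - q powr (\<nu> + 1)) * (1 - q) / (9 * q powr (\<nu> + 1))) < rc \<and>
     rc < sqrt (36 * (q\<^sup>2 - 1) * (1 - q powr (\<nu> + 1)) * (1 - q powr (\<nu> + 2))
                / (q powr (\<nu> + 1) * S_poly \<nu> q)) \<and>
     2 * root 4 ((1 + q) * (1 - q)\<^sup>2 * (1 - q powr (\<nu> + 1))\<^sup>2 * (q powr (\<nu> + 2) - 1)
                / (q powr (2 * (\<nu> + 1)) * S_poly \<nu> q)) < rc \<and>
     rc < sqrt (4 * (1 - q powr (\<nu> + 1)) * (1 - q powr (\<nu> + 3)) * T_poly q * S_poly \<nu> q
                / (q powr (\<nu> + 1) * (1 + q) * (P_poly \<nu> q + R_poly \<nu> q)))"
proof -
  have nu: "- 1 < \<nu>" and q: "0 < q" "q < 1" using assms by auto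
  note b = qpowr_bounds[OF nu q]
  define a e where "a = bessel_coeff q (q powr (\<nu> + 1))" and "e = theta_coeffs (theta_coeffs a)"
  obtain X where X: "root_limit a X" unfolding a_def using bessel_root_limit[OF nu q] by blast
  obtain Y where Y: "root_limit (theta_coeffs a) Y" using root_limit_theta[OF X] by blast
  obtain Z where Z: "root_limit e Z" unfolding e_def using root_limit_theta[OF Y] by blast
  obtain \<alpha> \<kappa> where r: "0 < \<alpha>" "\<alpha> \<le> 25 / 162" "0 < \<kappa>" "\<kappa> \<le> 294 / 625"
    "e 1 = 9 * q powr (\<nu> + 1) / (4 * (1 - q) * (1 - q powr (\<nu> + 1)))"
    "e 2 = \<alpha> * (e 1)\<^sup>2" "e 3 = \<kappa> * \<alpha>\<^sup>2 * e 1 ^ 3"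
    using bessel_ratios[OF q b] unfolding e_def a_def by metis
  have e1: "0 < e 1" unfolding r(5) using q b by simp
  note gaps = psum_gaps[OF e1 r(6,7) r(1-4)]
  obtain \<gamma> where \<gamma>: "0 < \<gamma>" "alt_series e \<gamma> = 0" "\<And>s. 0 \<le> s \<Longrightarrow> s < \<gamma> \<Longrightarrow> 0 < alt_series e s"
    "1 \<le> \<gamma> ^ 3 * psum3 e" "\<gamma> * psum3 e \<le> psum2 e"
    using least_zero[OF Z gaps(1,2)] by blast
  note bounds = least_zero_bounds[OF \<gamma>(1,4,5) e1 gaps(1,2,4,5,6)]
  note eqs = bessel_bounds_eq[OF q b refl, folded a_def, folded e_def, OF e1 gaps(1,3)]
  have "radius_of_convexity (normalized_bessel2 \<nu> q) = ereal (sqrt \<gamma>)"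
    using \<gamma> normalized_bessel2_alt_series[OF nu q]
    by (intro radius_of_convexity_odd_series[OF X]) (auto simp: a_def e_def)
  moreover have "smallest_positive_root (\<lambda>r.
         of_real ((1 - \<nu>)\<^sup>2) * jackson_bessel2 \<nu> q (of_real r)
       + of_real ((3 - 2 * \<nu>) * r) * deriv (jackson_bessel2 \<nu> q) (of_real r)
       + of_real (r\<^sup>2) * deriv (deriv (jackson_bessel2 \<nu> q)) (of_real r)) (sqrt \<gamma>)"
    unfolding smallest_positive_root_def
  proof (intro conjI allI impI)
    show "0 < sqrt \<gamma>" using \<gamma>(1) by simp
    note equation = bessel_equation[OF nu q, folded a_def, folded e_def]
    show "of_real ((1 - \<nu>)\<^sup>2) * jackson_bessel2 \<nu> q (of_real (sqrt \<gamma>))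
       + of_real ((3 - 2 * \<nu>) * sqrt \<gamma>) * deriv (jackson_bessel2 \<nu> q) (of_real (sqrt \<gamma>))
       + of_real ((sqrt \<gamma>)\<^sup>2) * deriv (deriv (jackson_bessel2 \<nu> q)) (of_real (sqrt \<gamma>)) = 0"
      unfolding equation[OF \<open>0 < sqrt \<gamma>\<close>] using \<gamma>(1,2) by simp
    fix s :: real
    assume s: "0 < s \<and> of_real ((1 - \<nu>)\<^sup>2) * jackson_bessel2 \<nu> q (of_real s)
       + of_real ((3 - 2 * \<nu>) * s) * deriv (jackson_bessel2 \<nu> q) (of_real s)
       + of_real (s\<^sup>2) * deriv (deriv (jackson_bessel2 \<nu> q)) (of_real s) = 0"
    then have "alt_series e (s\<^sup>2) = (0::real)" using equation[of s] by blast
    with \<gamma>(3)[of "s\<^sup>2"] have "\<gamma> \<le> s\<^sup>2" by force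
    then show "sqrt \<gamma> \<le> s" using s by (intro real_le_lsqrt) auto
  qed
  moreover have "sqrt (1 / e 1) < sqrt \<gamma>" using bounds(1) e1 by (simp add: divide_less_eq)
  moreover have "sqrt \<gamma> < sqrt (e 1 / psum2 e)" using bounds(3) gaps(1) by (simp add: less_divide_eq)
  moreover have "2 * root 4 (1 / (16 * psum2 e)) < sqrt \<gamma>"
  proof -
    have "(sqrt \<gamma> / 2) ^ 4 = \<gamma>\<^sup>2 / 16"
      using \<gamma>(1) power_mult[of "sqrt \<gamma>" 2 2] by (simp add: power_divide)
    moreover have "1 / (16 * psum2 e) < \<gamma>\<^sup>2 / 16"
      using bounds(2) gaps(1) by (simp add: field_simps)
    ultimately have "root 4 (1 / (16 * psum2 e)) < root 4 ((sqrt \<gamma> / 2) ^ 4)" by simp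
    also have "root 4 ((sqrt \<gamma> / 2) ^ 4) = sqrt \<gamma> / 2"
      using \<gamma>(1) by (intro real_root_power_cancel) auto
    finally show ?thesis by simp
  qed
  moreover have "sqrt \<gamma> < sqrt (psum2 e / (psum3 e - e 3))"
  proof -
    have "0 < e 3" unfolding r(7) using r(1,3) e1 by simp
    then have "\<gamma> * (psum3 e - e 3) < \<gamma> * psum3 e" using \<gamma>(1) by simp
    then have "\<gamma> * (psum3 e - e 3) < psum2 e" using \<gamma>(5) by linarith
    then show ?thesis using gaps(3) by (simp add: less_divide_eq)
  qed
  ultimately show ?thesis unfolding eqs by blast
qed

end
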